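(* Let $h\ge 2$ be an integer and let $G\sim G_n^h$ or $G\sim \tilde G_n^h$ (two preferential attachment models). Then there exists a constant $c>0$ such that, as $n\to\infty$ with $h$ fixed, $$\mathbb P\big(\alpha(G)\ge 0.03418\,h\big)\ \ge\ 1-o(n^{-c}).$$
   Context: Graphs are finite multigraphs (loops and multiple edges allowed). For a graph $G=(V,E)$ and $S\subseteq V$, $\bar S=V\setminus S$, and $e(S,\bar S)$ is the number of edges (with multiplicity) having one endpoint in $S$ and the other in $\bar S$. The edge expansion of $G$ is $$\alpha(G)=\min_{S\subseteq V,\ 1\le |S|\le |V|/2}\frac{e(S,\bar S)}{|S|},$$ with $\alpha(G)=\infty$ if $|V|/2<1$. Model $G_n^h$ ($h,n\in\mathbb N$). $T_1$ is a single mini-vertex $1$ with a loop $e_1$ (so it has degree $2$). For $t\ge1$, $T_{t+1}$ is obtained from $T_t$ by adding a mini-vertex $t+1$ and an edge $e_{t+1}$ joining $t+1$ to a random mini-vertex $i$, where, conditionally on $T_t$, $\mathbb P(i=s)=\deg_{T_t}(s)/(2t+1)$ for $1\le s\le t$ and $\mathbb P(i=t+1)=1/(2t+1)$ (in which case $e_{t+1}$ is a loop). Loops count $2$ towards the degree. $G_n^h$ is the random multigraph on $\{1,\dots,n\}$ obtained from $T_{hn}$ by merging, for each $i\in\{1,\dots,n\}$, the mini-vertices $h(i-1)+1,\dots,h(i-1)+h$ into a single vertex $i$, keeping loops and multiple edges. Model $\tilde G_n^h$. $\tilde T_1$ is a single mini-vertex $1$ with a loop $e_1$, where this loop contributes only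 $1$ to the degree of mini-vertex $1$. For $t\ge 1$, $\tilde T_{t+1}$ is obtained from $\tilde T_t$ by adding a mini-vertex $t+1$ and an edge $e_{t+1}$ joining it to a random mini-vertex $i\in\{1,\dots,t\}$ with, conditionally on $\tilde T_t$, $\mathbb P(i=s)=\deg_{\tilde T_t}(s)/(2t-1)$ for $1\le s\le t$. $\tilde G_n^h$ is obtained from $\tilde T_{hn}$ by the same merging of consecutive blocks of $h$ mini-vertices. The loop $e_1$ contributes $1$ to the degree of its vertex; every other loop contributes $2$. *)

theory Defs
  imports "HOL-Probability.Probability" "HOL-Library.Landau_Symbols" "HOL-Library.Uprod"
begin

section \<open>Finite multigraphs and edge expansion\<close>

text \<open>A loop at \<open>v\<close> is the unordered pair \<open>Upair v v\<close>.\<close>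

record 'a multigraph =
  verts :: "'a set"
  edges :: "'a uprod multiset"

definition deg :: "'a multigraph \<Rightarrow> 'a \<Rightarrow> nat" where
  "deg G v = size {#e \<in># edges G. v \<in> set_uprod e#} + size {#e \<in># edges G. e = Upair v v#}"

definition cut_size :: "'a multigraph \<Rightarrow> 'a set \<Rightarrow> nat" where
  "cut_size G S = size {#e \<in># edges G. \<exists>u\<in>S. \<exists>v\<in>verts G - S. e = Upair u v#}"

definition edge_expansion :: "'a multigraph \<Rightarrow> ereal" where
  "edge_expansion G =
     (if real (card (verts G)) / 2 < 1 then \<infinity>
      else ereal (Min {real (cut_size G S) / real (card S) | S.
             S \<subseteq> verts G \<and> 1 \<le> card S \<and> real (card S) \<le> real (card (verts G)) / 2}))"

section \<open>The mini-vertex processes\<close>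

definition initial_graph :: "nat multigraph" where
  "initial_graph = \<lparr>verts = {1}, edges = {#Upair 1 1#}\<rparr>"

definition attach :: "nat \<Rightarrow> nat multigraph \<Rightarrow> nat \<Rightarrow> nat multigraph" where
  "attach t G i =
     \<lparr>verts = insert (t + 1) (verts G), edges = add_mset (Upair (t + 1) i) (edges G)\<rparr>"

text \<open>
  The distributions of the endpoint \<open>i\<close> of the new edge, given the graph \<open>G\<close> at time \<open>t\<close>.
  The constant \<open>embed_pmf\<close> is only meaningful for nonnegative weights of total mass one. The lemmas
  \<open>pmf_target\<close> and \<open>pmf_target_tilde\<close> below show that the weights do have this property on all
  graphs reached by the processes.
\<close>

definition target :: "nat \<Rightarrow> nat multigraph \<Rightarrow> nat pmf" where
  "target t G = embed_pmf (\<lambda>s.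
     if 1 \<le> s \<and> s \<le> t then real (deg G s) / (2 * real t + 1)
     else if s = t + 1 then 1 / (2 * real t + 1)
     else 0)"

text \<open>In the second model the initial loop, at mini-vertex 1, contributes only 1 to the degree.\<close>

definition deg_tilde :: "nat multigraph \<Rightarrow> nat \<Rightarrow> nat" where
  "deg_tilde G s = (if s = 1 then deg G s - 1 else deg G s)"

definition target_tilde :: "nat \<Rightarrow> nat multigraph \<Rightarrow> nat pmf" where
  "target_tilde t G = embed_pmf (\<lambda>s.
     if 1 \<le> s \<and> s \<le> t then real (deg_tilde G s) / (2 * real t - 1)
     else 0)"

text \<open>The processes start at time 1. The value at time 0 is a dummy.\<close>

fun mini_tree :: "nat \<Rightarrow> nat multigraph pmf" where
  "mini_tree 0 = return_pmf \<lparr>verts = {}, edges = {#}\<rparr>"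
| "mini_tree (Suc 0) = return_pmf initial_graph"
| "mini_tree (Suc (Suc t)) =
     bind_pmf (mini_tree (Suc t)) (\<lambda>G. map_pmf (attach (Suc t) G) (target (Suc t) G))"

fun mini_tree_tilde :: "nat \<Rightarrow> nat multigraph pmf" where
  "mini_tree_tilde 0 = return_pmf \<lparr>verts = {}, edges = {#}\<rparr>"
| "mini_tree_tilde (Suc 0) = return_pmf initial_graph"
| "mini_tree_tilde (Suc (Suc t)) =
     bind_pmf (mini_tree_tilde (Suc t)) (\<lambda>G. map_pmf (attach (Suc t) G) (target_tilde (Suc t) G))"

section \<open>Merging blocks of mini-vertices\<close>

definition block :: "nat \<Rightarrow> nat \<Rightarrow> nat" where
  "block h j = (j - 1) div h + 1"

definition merge :: "nat \<Rightarrow> nat multigraph \<Rightarrow> nat multigraph" where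
  "merge h G = \<lparr>verts = block h ` verts G, edges = image_mset (map_uprod (block h)) (edges G)\<rparr>"

definition pref_attach :: "nat \<Rightarrow> nat \<Rightarrow> nat multigraph pmf" where
  "pref_attach h n = map_pmf (merge h) (mini_tree (h * n))"

definition pref_attach_tilde :: "nat \<Rightarrow> nat \<Rightarrow> nat multigraph pmf" where
  "pref_attach_tilde h n = map_pmf (merge h) (mini_tree_tilde (h * n))"

lemma block_eq_iff:
  assumes "h \<ge> 1" "i \<ge> 1" "j \<ge> 1"
  shows "block h j = i \<longleftrightarrow> h * (i - 1) + 1 \<le> j \<and> j \<le> h * (i - 1) + h"
proof -
  have "block h j = i \<longleftrightarrow> (j - 1) div h = i - 1"
    using assms by (auto simp: block_def)
  also have "\<dots> \<longleftrightarrow> h * (i - 1) \<le> j - 1 \<and> j - 1 < h * (i - 1) + h"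
  proof
    assume "(j - 1) div h = i - 1"
    then have "j - 1 = h * (i - 1) + (j - 1) mod h"
      using mult_div_mod_eq[of h "j - 1"] by simp
    moreover have "(j - 1) mod h < h"
      using assms by simp
    ultimately show "h * (i - 1) \<le> j - 1 \<and> j - 1 < h * (i - 1) + h"
      by linarith
  next
    assume "h * (i - 1) \<le> j - 1 \<and> j - 1 < h * (i - 1) + h"
    then show "(j - 1) div h = i - 1"
      by (intro div_nat_eqI) (simp_all add: mult.commute)
  qed
  finally show ?thesis
    using assms by linarith
qed

section \<open>The attachment distributions are well-defined\<close>

definition wf_at :: "nat \<Rightarrow> nat multigraph \<Rightarrow> bool" where
  "wf_at t G \<longleftrightarrow> verts G = {1..t} \<and> (\<forall>e\<in>#edges G. set_uprod e \<subseteq> {1..t}) \<and>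
     (\<Sum>s=1..t. deg G s) = 2 * t \<and> Upair 1 1 \<in># edges G"

lemma deg_attach:
  "deg (attach t G i) v = deg G v + of_bool (v = t + 1) + of_bool (v = i)"
  by (auto simp: deg_def attach_def)

lemma wf_at_initial: "wf_at (Suc 0) initial_graph"
  by (simp add: wf_at_def initial_graph_def deg_def)

lemma wf_at_attach:
  assumes "wf_at t G" "i \<in> {1..t + 1}"
  shows "wf_at (Suc t) (attach t G i)"
proof -
  have notin: "Suc t \<notin> set_uprod e" if "e \<in># edges G" for e
    using that assms(1) by (force simp: wf_at_def)
  then have "e \<noteq> Upair (Suc t) (Suc t)" if "e \<in># edges G" for e
    using that by force
  then have new: "deg G (Suc t) = 0"
    using notin by (simp add: deg_def filter_mset_eq_conv)
  have "(\<Sum>s=1..Suc t. deg (attach t G i) s) =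
      (\<Sum>s=1..Suc t. deg G s) + (\<Sum>s=1..Suc t. of_bool (s = Suc t)) + (\<Sum>s=1..Suc t. of_bool (s = i))"
    by (simp only: deg_attach sum.distrib Suc_eq_plus1)
  also have "(\<Sum>s=1..Suc t. of_bool (s = Suc t)) = (1::nat)"
    by (simp add: of_bool_def sum.delta)
  also have "(\<Sum>s=1..Suc t. of_bool (s = i)) = (1::nat)"
    using assms(2) by (simp add: of_bool_def sum.delta del: sum.cl_ivl_Suc)
  also have "(\<Sum>s=1..Suc t. deg G s) = 2 * t"
    using assms(1) new by (simp add: wf_at_def)
  finally have sum: "(\<Sum>s=1..Suc t. deg (attach t G i) s) = 2 * Suc t"
    by simp
  have "set_uprod e \<subseteq> {1..Suc t}" if "e \<in># edges (attach t G i)" for e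
    using that assms by (force simp: wf_at_def attach_def)
  moreover have "verts (attach t G i) = {1..Suc t}" "Upair 1 1 \<in># edges (attach t G i)"
    using assms(1) by (auto simp: wf_at_def attach_def)
  ultimately show ?thesis
    using sum unfolding wf_at_def by blast
qed

lemma pmf_embed_finite:
  assumes "finite A" "\<And>s. s \<notin> A \<Longrightarrow> f s = 0" "\<And>s. 0 \<le> f s" "sum f A = 1"
  shows "pmf (embed_pmf f) = f"
proof -
  have "(\<integral>\<^sup>+s. ennreal (f s) \<partial>count_space UNIV) = (\<Sum>s\<in>A. ennreal (f s))"
    using assms by (intro nn_integral_count_space'[of A]) auto
  also have "\<dots> = 1"
    using assms by (simp add: sum_ennreal)
  finally show ?thesis
    using assms(3) by (auto intro!: ext pmf_embed_pmf)
qed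

lemma pmf_target_wf:
  assumes "wf_at t G"
  shows "pmf (target t G) s =
     (if 1 \<le> s \<and> s \<le> t then real (deg G s) / (2 * real t + 1)
      else if s = t + 1 then 1 / (2 * real t + 1) else 0)"
  unfolding target_def
proof (subst pmf_embed_finite[where A = "{1..Suc t}"])
  let ?f = "\<lambda>s. if 1 \<le> s \<and> s \<le> t then real (deg G s) / (2 * real t + 1)
      else if s = t + 1 then 1 / (2 * real t + 1) else 0"
  have "sum ?f {1..Suc t} = (\<Sum>s=1..t. real (deg G s) / (2 * real t + 1)) + 1 / (2 * real t + 1)"
    by simp
  also have "(\<Sum>s=1..t. real (deg G s) / (2 * real t + 1)) = real (\<Sum>s=1..t. deg G s) / (2 * real t + 1)"
    by (simp add: sum_divide_distrib)
  also have "\<dots> + 1 / (2 * real t + 1) = 1"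
    using assms by (simp add: wf_at_def field_simps)
  finally show "sum ?f {1..Suc t} = 1" .
qed auto

lemma pmf_target_tilde_wf:
  assumes "wf_at t G" "t \<ge> 1"
  shows "pmf (target_tilde t G) s =
     (if 1 \<le> s \<and> s \<le> t then real (deg_tilde G s) / (2 * real t - 1) else 0)"
  unfolding target_tilde_def
proof (subst pmf_embed_finite[where A = "{1..t}"])
  have ge: "deg G 1 \<ge> 1"
    using assms by (auto simp: wf_at_def deg_def dest!: multi_member_split)
  have "(\<Sum>s=1..t. real (deg_tilde G s)) = (\<Sum>s=1..t. real (deg G s) - of_bool (s = 1))"
    using ge by (intro sum.cong) (auto simp: deg_tilde_def)
  also have "\<dots> = real (\<Sum>s=1..t. deg G s) - (\<Sum>s=1..t. of_bool (s = 1))"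
    by (simp add: sum_subtractf)
  also have "(\<Sum>s=1..t. of_bool (s = 1)) = (1::real)"
    using assms(2) by (simp add: of_bool_def sum.delta)
  finally have "(\<Sum>s=1..t. real (deg_tilde G s)) = 2 * real t - 1"
    using assms by (simp add: wf_at_def del: of_nat_sum)
  then show "(\<Sum>s=1..t. if 1 \<le> s \<and> s \<le> t then real (deg_tilde G s) / (2 * real t - 1) else 0) = 1"
    using assms(2) by (simp flip: sum_divide_distrib)
qed (use assms in auto)

lemma mini_tree_wf: "G \<in> set_pmf (mini_tree (Suc t)) \<Longrightarrow> wf_at (Suc t) G"
proof (induction t arbitrary: G)
  case (Suc t)
  then obtain H i where H: "wf_at (Suc t) H" "i \<in> set_pmf (target (Suc t) H)" "G = attach (Suc t) H i"
    by auto
  have "i \<in> {1..Suc t + 1}"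
    using H(2) by (auto simp: set_pmf_eq pmf_target_wf[OF H(1)] split: if_splits)
  then show ?case
    using H wf_at_attach by blast
qed (simp add: wf_at_initial)

lemma mini_tree_tilde_wf: "G \<in> set_pmf (mini_tree_tilde (Suc t)) \<Longrightarrow> wf_at (Suc t) G"
proof (induction t arbitrary: G)
  case (Suc t)
  then obtain H i where H: "wf_at (Suc t) H" "i \<in> set_pmf (target_tilde (Suc t) H)"
      "G = attach (Suc t) H i"
    by auto
  have "i \<in> {1..Suc t + 1}"
    using H(2) by (auto simp: set_pmf_eq pmf_target_tilde_wf[OF H(1)] split: if_splits)
  then show ?case
    using H wf_at_attach by blast
qed (simp add: wf_at_initial)

lemma pmf_target:
  assumes "t \<ge> 1" "G \<in> set_pmf (mini_tree t)"
  shows "pmf (target t G) s =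
     (if 1 \<le> s \<and> s \<le> t then real (deg G s) / (2 * real t + 1)
      else if s = t + 1 then 1 / (2 * real t + 1) else 0)"
  using assms mini_tree_wf[of G "t - 1"] by (intro pmf_target_wf) simp

lemma pmf_target_tilde:
  assumes "t \<ge> 1" "G \<in> set_pmf (mini_tree_tilde t)"
  shows "pmf (target_tilde t G) s =
     (if 1 \<le> s \<and> s \<le> t then real (deg_tilde G s) / (2 * real t - 1) else 0)"
  using assms mini_tree_tilde_wf[of G "t - 1"] by (intro pmf_target_tilde_wf) simp_all

end

theory Submission
  imports Defs "HOL-Real_Asymp.Real_Asymp"
begin

text \<open>
  Fix a set of \<open>k \<le> n / 2\<close> vertices, that is, a set \<open>S\<close> of \<open>m = h * k\<close> of the \<open>N = h * n\<close>
  mini-vertices, and let \<open>T\<close> be its complement. As long as no edge crosses between \<open>S\<close> and \<open>T\<close>, the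
  two degree sums follow a Polya urn, and the probability that no edge ever crosses is about
  \<open>1 / (N choose m)\<close>, whatever the order in which the mini-vertices of \<open>S\<close> arrive. This is at most
  \<open>1 / (n choose k) ^ h\<close>, and there are only \<open>n choose k\<close> sets of this size, so for \<open>h \<ge> 2\<close> a union
  bound has at least half of the factors to spare.

  The spare factors pay for up to \<open>0.03418 * m\<close> crossing edges. Their number is controlled by an
  exponential moment: with \<open>x\<close> and \<open>y\<close> the degree sums of \<open>S\<close> and \<open>T\<close> and \<open>c\<close> the number of
  crossing edges so far, the weight
  \<open>sqrt ((x + y) choose x) * \<theta> ^ c * sqrt (fact c / (4 * N) ^ c)\<close> grows in mean by at most a factor \<open>1 + \<theta>\<close> per step (\<open>weighted_step\<close> and \<open>weight_expectation\<close>).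
  Indeed, a step that does not cross multiplies \<open>sqrt ((x + y) choose x)\<close> by at most the inverse of
  its probability, and a crossing step loses at most \<open>sqrt (4 * N / (c + 1))\<close>, because both degree
  sums are at least \<open>c\<close>. If few edges cross, then the final \<open>x\<close> is close to \<open>2 * m\<close> and the weight is
  large, so Markov's inequality bounds the probability of a sparse cut (\<open>weighted_tail\<close>).

  For the second model, \<open>x\<close> and \<open>y\<close> are lowered by small constants, which costs a factor of order
  \<open>N\<close>. Sets so small that a sparse cut must be empty are harmless there, because the graph is
  connected; for larger sets, the spare power of \<open>n / k\<close> absorbs the factor (\<open>tail_bound_term\<close>). The
  sum over \<open>k\<close> is of order \<open>n powr (- 0.2)\<close>.
\<close>

section \<open>Volumes and crossing edges\<close>

definition splits :: "nat \<Rightarrow> nat set \<Rightarrow> nat set \<Rightarrow> bool" where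
  "splits N S T \<longleftrightarrow> S \<union> T = {1..N} \<and> S \<inter> T = {}"

lemma splits_commute: "splits N S T \<Longrightarrow> splits N T S"
  by (auto simp: splits_def)

lemma splits_finite:
  assumes "splits N S T"
  shows "finite S" "finite T"
  using assms by (metis splits_def finite_Un finite_atLeastAtMost)+

definition vol :: "nat set \<Rightarrow> nat multigraph \<Rightarrow> nat" where
  "vol S G = (\<Sum>s\<in>S. deg G s)"

definition cross :: "nat set \<Rightarrow> nat set \<Rightarrow> nat multigraph \<Rightarrow> nat" where
  "cross S T G = size {#e \<in># edges G. \<exists>u\<in>S. \<exists>v\<in>T. e = Upair u v#}"

lemma cross_commute: "cross S T G = cross T S G"
proof -
  have "(\<exists>u\<in>S. \<exists>v\<in>T. e = Upair u v) \<longleftrightarrow> (\<exists>u\<in>T. \<exists>v\<in>S. e = Upair u v)" for e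
    by (metis Upair_inject)
  then show ?thesis
    by (simp add: cross_def)
qed

lemma vol_initial:
  assumes "finite S"
  shows "vol S initial_graph = 2 * of_bool (1 \<in> S)"
proof -
  have "deg initial_graph s = (if s = 1 then 2 else 0)" for s
    by (simp add: deg_def initial_graph_def)
  then have "vol S initial_graph = (\<Sum>s\<in>S. if s = 1 then 2 else 0)"
    unfolding vol_def by presburger
  then show ?thesis
    using assms by simp
qed

lemma vol_attach:
  assumes "finite S"
  shows "vol S (attach t G i) = vol S G + of_bool (Suc t \<in> S) + of_bool (i \<in> S)"
proof -
  have "(\<Sum>s\<in>S. of_bool (s = j)) = (of_bool (j \<in> S) :: nat)" for j
    using assms by (simp add: of_bool_def)
  then show ?thesis
    by (simp add: vol_def deg_attach sum.distrib)
qed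

lemma cross_attach:
  assumes "splits N S T" "Suc t \<in> S" "i \<in> S \<union> T"
  shows "cross S T (attach t G i) = cross S T G + of_bool (i \<in> T)"
proof -
  have "(\<exists>u\<in>S. \<exists>v\<in>T. Upair (Suc t) i = Upair u v) \<longleftrightarrow> i \<in> T"
    using assms by (auto simp: splits_def)
  then show ?thesis
    by (simp add: cross_def attach_def)
qed

text \<open>
  The graphs that either process can reach. The volume and crossing counts obey deterministic
  relations on all of them, whatever the probabilities of the attachments are.
\<close>

inductive grown :: "nat \<Rightarrow> nat multigraph \<Rightarrow> bool" where
  "grown 1 initial_graph"
| "grown t G \<Longrightarrow> i \<in> {1..t + 1} \<Longrightarrow> grown (Suc t) (attach t G i)"

lemma grown_wf_at: "grown t G \<Longrightarrow> wf_at t G"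
  by (induction rule: grown.induct) (use wf_at_initial wf_at_attach in auto)

lemma grown_deg_unborn:
  assumes "grown t G" "s \<notin> {1..t}"
  shows "deg G s = 0"
proof -
  have "s \<notin> set_uprod e" "e \<noteq> Upair s s" if "e \<in># edges G" for e
    using that grown_wf_at[OF assms(1)] assms(2) by (force simp: wf_at_def)+
  then show ?thesis
    by (simp add: deg_def filter_mset_eq_conv)
qed

lemma grown_mini_tree: "G \<in> set_pmf (mini_tree (Suc t)) \<Longrightarrow> grown (Suc t) G"
proof (induction t arbitrary: G)
  case 0
  then show ?case
    using grown.intros(1) by simp
next
  case (Suc t)
  then obtain H i where H: "grown (Suc t) H" "i \<in> set_pmf (target (Suc t) H)" "G = attach (Suc t) H i"
    by auto
  have "i \<in> {1..Suc t + 1}"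
    using H(2) by (auto simp: set_pmf_eq pmf_target_wf[OF grown_wf_at[OF H(1)]] split: if_splits)
  then show ?case
    using H grown.intros(2) by blast
qed

lemma target_tilde_old:
  assumes "grown t G" "t \<ge> 1" "i \<in> set_pmf (target_tilde t G)"
  shows "i \<in> {1..t}"
  using assms(3)
  by (auto simp: set_pmf_eq pmf_target_tilde_wf[OF grown_wf_at[OF assms(1)] assms(2)] split: if_splits)

lemma grown_mini_tree_tilde: "G \<in> set_pmf (mini_tree_tilde (Suc t)) \<Longrightarrow> grown (Suc t) G"
proof (induction t arbitrary: G)
  case 0
  then show ?case
    using grown.intros(1) by simp
next
  case (Suc t)
  then obtain H i where H: "grown (Suc t) H" "i \<in> set_pmf (target_tilde (Suc t) H)"
      "G = attach (Suc t) H i"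
    by auto
  have "i \<in> {1..Suc t + 1}"
    using target_tilde_old[OF H(1) _ H(2)] by simp
  then show ?case
    using H grown.intros(2) by blast
qed

text \<open>
  A new mini-vertex of the second model attaches to an older one, so the first mini-vertex on the
  side without mini-vertex 1 creates a crossing edge.
\<close>

lemma tilde_connected:
  assumes "splits N S T" "1 \<in> T"
  shows "G \<in> set_pmf (mini_tree_tilde (Suc t)) \<Longrightarrow> Suc t \<le> N \<Longrightarrow> S \<inter> {1..Suc t} \<noteq> {} \<Longrightarrow>
    cross S T G \<ge> 1"
proof (induction t arbitrary: G)
  case 0
  then show ?case
    using assms by (auto simp: splits_def)
next
  case (Suc t)
  from Suc.prems(1) obtain H i where H: "H \<in> set_pmf (mini_tree_tilde (Suc t))"
      "i \<in> set_pmf (target_tilde (Suc t) H)" "G = attach (Suc t) H i"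
    by auto
  have i: "i \<in> {1..Suc t}"
    using target_tilde_old[OF grown_mini_tree_tilde[OF H(1)] _ H(2)] by simp
  have N: "{1..Suc (Suc t)} \<subseteq> S \<union> T"
    using Suc.prems(2) assms(1) by (auto simp: splits_def)
  have mono: "cross S T H \<le> cross S T G"
    by (simp add: H(3) cross_def attach_def)
  show ?case
  proof (cases "S \<inter> {1..Suc t} = {}")
    case True
    then have "Suc (Suc t) \<in> S"
      using Suc.prems(3) by (metis Int_insert_right_if0 atLeastAtMostSuc_conv le_add1 plus_1_eq_Suc)
    moreover have "i \<in> T"
      using True i N by fastforce
    ultimately show ?thesis
      using cross_attach[OF assms(1)] by (simp add: H(3))
  next
    case False
    then have "cross S T H \<ge> 1"
      using Suc.IH[OF H(1)] Suc.prems(2) by simp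
    then show ?thesis
      using mono by simp
  qed
qed

lemma grown_half_edges:
  assumes "grown t G" "splits N S T" "t \<le> N"
  shows "vol S G + vol T G = 2 * t"
  using assms(1,3)
proof (induction rule: grown.induct)
  case 1
  have "1 \<in> S \<longleftrightarrow> 1 \<notin> T"
    using 1 assms(2) by (auto simp: splits_def)
  then show ?case
    using splits_finite[OF assms(2)] by (simp add: vol_initial)
next
  case (2 t G i)
  have mem: "j \<in> S \<longleftrightarrow> j \<notin> T" if "j \<in> {1..Suc t}" for j
    using that 2 assms(2) by (fastforce simp: splits_def)
  show ?case
    using 2 mem[of i] mem[of "Suc t"] splits_finite[OF assms(2)] by (simp add: vol_attach)
qed

text \<open>
  Every crossing edge puts a half-edge into \<open>S\<close>, and the initial loop adds one more when it lies
  in \<open>S\<close>; this extra unit keeps the first bound alive after the second model has lowered the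
  degree of mini-vertex 1. The second bound holds because each mini-vertex of \<open>S\<close> brings an edge
  whose two ends are in \<open>S\<close> unless the edge crosses. Together with the bound for \<open>T\<close>, it locates
  the final volume of \<open>S\<close> up to the number of crossing edges.
\<close>

lemma grown_cross_le:
  assumes "grown t G" "splits N S T" "t \<le> N"
  shows "cross S T G + of_bool (1 \<in> S) \<le> vol S G"
    and "2 * card (S \<inter> {1..t}) \<le> vol S G + cross S T G"
proof -
  have "cross S T G + of_bool (1 \<in> S) \<le> vol S G \<and> 2 * card (S \<inter> {1..t}) \<le> vol S G + cross S T G"
    using assms(1,3)
  proof (induction rule: grown.induct)
    case 1
    have "cross S T initial_graph = 0"
      using assms(2) by (auto simp: cross_def initial_graph_def splits_def)
    then show ?case
      using splits_finite[OF assms(2)] by (cases "1 \<in> S") (auto simp: vol_initial)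
  next
    case (2 t G i)
    have fin: "finite S"
      using splits_finite[OF assms(2)] by simp
    have mem: "j \<in> S \<longleftrightarrow> j \<notin> T" if "j \<in> {1..Suc t}" for j
      using that 2 assms(2) by (fastforce simp: splits_def)
    have ST: "i \<in> S \<union> T"
      using mem[of i] 2 by auto
    have eq: "S \<inter> {1..Suc t} = (if Suc t \<in> S then insert (Suc t) (S \<inter> {1..t}) else S \<inter> {1..t})"
      by (auto simp: le_Suc_eq)
    have card: "card (S \<inter> {1..Suc t}) = card (S \<inter> {1..t}) + of_bool (Suc t \<in> S)"
      unfolding eq by simp
    have IH: "cross S T G + of_bool (1 \<in> S) \<le> vol S G" "2 * card (S \<inter> {1..t}) \<le> vol S G + cross S T G"
      using 2 by auto
    show ?case
    proof (cases "Suc t \<in> S")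
      case True
      then show ?thesis
        using IH cross_attach[OF assms(2) True ST] mem[of i] 2(2) fin card
        by (cases "1 \<in> S"; cases "i \<in> T") (auto simp: vol_attach)
    next
      case False
      then have T: "Suc t \<in> T"
        using mem[of "Suc t"] by simp
      have "cross S T (attach t G i) = cross S T G + of_bool (i \<in> S)"
        using cross_attach[OF splits_commute[OF assms(2)] T, of i G] ST
        by (simp add: cross_commute Un_commute)
      then show ?thesis
        using IH False fin card
        by (cases "1 \<in> S"; cases "i \<in> S") (auto simp: vol_attach)
    qed
  qed
  then show "cross S T G + of_bool (1 \<in> S) \<le> vol S G"
    and "2 * card (S \<inter> {1..t}) \<le> vol S G + cross S T G"
    by auto
qed

section \<open>Potentials for a Polya urn with crossings\<close>

definition arrangements :: "nat \<Rightarrow> nat \<Rightarrow> real" where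
  "arrangements x y = real ((x + y) choose x)"

lemma arrangements_commute: "arrangements x y = arrangements y x"
  unfolding arrangements_def using binomial_symmetric[of x "x + y"] by (simp add: add.commute)

lemma arrangements_pos: "arrangements x y > 0"
  by (simp add: arrangements_def)

lemma arrangements_0: "arrangements 0 y = 1" "arrangements x 0 = 1"
  by (simp_all add: arrangements_def)

lemma arrangements_fact: "arrangements x y = fact (x + y) / (fact x * fact y)"
  by (simp add: arrangements_def binomial_fact)

lemma arrangements_add2:
  "arrangements (Suc (Suc x)) y =
    arrangements x y * ((real x + real y + 1) * (real x + real y + 2) / ((real x + 1) * (real x + 2)))"
proof -
  have "fact (Suc (Suc x) + y) = (real x + real y + 2) * (real x + real y + 1) * fact (x + y)"
    by (simp add: algebra_simps)
  moreover have "fact (Suc (Suc x)) = (real x + 2) * (real x + 1) * fact x"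
    by (simp add: algebra_simps)
  ultimately show ?thesis
    unfolding arrangements_fact by (simp only: times_divide_times_eq) (simp only: mult_ac)
qed

lemma arrangements_add_both:
  "arrangements (Suc x) (Suc y) =
    arrangements x y * ((real x + real y + 1) * (real x + real y + 2) / ((real x + 1) * (real y + 1)))"
proof -
  have "fact (Suc x + Suc y) = (real x + real y + 2) * (real x + real y + 1) * fact (x + y)"
    by (simp add: algebra_simps)
  moreover have "fact (Suc x) = (real x + 1) * fact x" "fact (Suc y) = (real y + 1) * fact y"
    by (simp_all add: algebra_simps)
  ultimately show ?thesis
    unfolding arrangements_fact by (simp only: times_divide_times_eq) (simp only: mult_ac)
qed

text \<open>
  Without crossing edges, the two volumes are those of a Polya urn whose colours come in a prescribed
  order. The probability of following that order is of size \<open>1 / sqrt (arrangements x y)\<close>: a step on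
  the side of volume \<open>x\<close> has probability \<open>(x + 1) / (x + y + 1)\<close>, and multiplies \<open>arrangements x y\<close>
  by about the inverse square of this probability. The potentials are kept squared, which turns all
  step inequalities into statements about rational functions.
\<close>

lemma arrangements_stay:
  "((real x + 1) / (real x + real y + 1))\<^sup>2 * arrangements (Suc (Suc x)) y \<le> arrangements x y"
proof -
  define a b where "a = real x" and "b = real y"
  have ab: "a \<ge> 0" "b \<ge> 0"
    by (auto simp: a_def b_def)
  have "((a + 1) / (a + b + 1))\<^sup>2 * ((a + b + 1) * (a + b + 2) / ((a + 1) * (a + 2)))
      = ((a + 1) * (a + b + 2)) / ((a + b + 1) * (a + 2))"
    using ab by (simp add: divide_simps power2_eq_square)
  also have "\<dots> \<le> 1"
    using ab by (simp add: divide_simps) (simp add: algebra_simps)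
  finally have "((a + 1) / (a + b + 1))\<^sup>2 * ((a + b + 1) * (a + b + 2) / ((a + 1) * (a + 2))) \<le> 1" .
  from mult_left_mono[OF this less_imp_le[OF arrangements_pos[of x y]]]
  show ?thesis
    by (simp add: arrangements_add2 a_def b_def mult_ac add_ac)
qed

text \<open>
  A crossing edge from the side of volume \<open>x\<close> costs a factor of about \<open>sqrt (y / (x + 1))\<close> in the
  weight. As \<open>x\<close> is at least the number \<open>c\<close> of earlier crossing edges and \<open>y\<close> at most \<open>2 * N\<close>, the
  cost of the crossing edges accumulates only to \<open>sqrt ((4 * N) ^ c / fact c)\<close>.
\<close>

lemma arrangements_switch:
  assumes "c \<le> x" "y \<le> 2 * N"
  shows "(real y / (real x + real y + 1))\<^sup>2 * arrangements (Suc x) (Suc y) * (real c + 1)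
    \<le> arrangements x y * (4 * real N)"
proof -
  define a b where "a = real x" and "b = real y"
  have ab: "a \<ge> 0" "b \<ge> 0" "real c \<le> a" "b \<le> 2 * real N"
    using assms by (auto simp: a_def b_def)
  have "(b / (a + b + 1))\<^sup>2 * ((a + b + 1) * (a + b + 2) / ((a + 1) * (b + 1))) * (real c + 1)
      = b * (b / (b + 1)) * ((real c + 1) / (a + 1)) * ((a + b + 2) / (a + b + 1))"
    using ab by (simp add: divide_simps power2_eq_square)
  also have "\<dots> \<le> 2 * real N * 1 * 1 * 2"
    using ab by (intro mult_mono) (auto simp: divide_simps)
  finally have "(b / (a + b + 1))\<^sup>2 * ((a + b + 1) * (a + b + 2) / ((a + 1) * (b + 1))) * (real c + 1)
      \<le> 4 * real N"
    by simp
  from mult_left_mono[OF this less_imp_le[OF arrangements_pos[of x y]]]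
  show ?thesis
    by (simp add: arrangements_add_both a_def b_def mult_ac add_ac)
qed

text \<open>
  In the second model a step that does not cross has probability \<open>x / (x + y)\<close>. In terms of the
  volumes lowered by one, this is at most the probability in the first model, so the same potential
  works. For an empty side the truncated subtraction makes the weight 1, which is what is needed: a
  side of volume 0 cannot receive an edge, and the first edge that leaves it crosses with
  probability 1.
\<close>

definition arrangements_tilde :: "nat \<Rightarrow> nat \<Rightarrow> real" where
  "arrangements_tilde x y = arrangements (x - 1) (y - 1)"

lemma arrangements_tilde_stay:
  "(real x / (real x + real y))\<^sup>2 * arrangements_tilde (Suc (Suc x)) y \<le> arrangements_tilde x y"
proof (cases "x = 0 \<or> y = 0")
  case True
  then show ?thesis
    by (cases "x = 0") (auto simp: arrangements_tilde_def arrangements_0 arrangements_def)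
next
  case False
  then obtain u v where uv: "x = Suc u" "y = Suc v"
    by (metis not0_implies_Suc)
  define a b where "a = real u" and "b = real v"
  have ab: "a \<ge> 0" "b \<ge> 0"
    by (auto simp: a_def b_def)
  have "((a + 1) / (a + b + 2))\<^sup>2 * ((a + b + 1) * (a + b + 2) / ((a + 1) * (a + 2)))
      = ((a + 1) / (a + 2)) * ((a + b + 1) / (a + b + 2))"
    using ab by (simp add: divide_simps power2_eq_square)
  also have "\<dots> \<le> 1 * 1"
    using ab by (intro mult_mono) auto
  finally have "((a + 1) / (a + b + 2))\<^sup>2 * ((a + b + 1) * (a + b + 2) / ((a + 1) * (a + 2))) \<le> 1"
    by simp
  from mult_left_mono[OF this less_imp_le[OF arrangements_pos[of u v]]]
  show ?thesis
    by (simp add: arrangements_tilde_def arrangements_add2 a_def b_def uv mult_ac add_ac)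
qed

lemma arrangements_tilde_switch:
  assumes "x + y > 0" "c \<le> x" "y \<le> 2 * N"
  shows "(real y / (real x + real y))\<^sup>2 * arrangements_tilde (Suc x) (Suc y) * (real c + 1)
    \<le> arrangements_tilde x y * (4 * real N)"
proof -
  consider "y = 0" | "x = 0" "y > 0" | "x > 0" "y > 0"
    by blast
  then show ?thesis
  proof cases
    case 1
    then show ?thesis
      by (simp add: arrangements_tilde_def arrangements_def)
  next
    case 2
    then have "N \<ge> 1" "c = 0"
      using assms by auto
    then show ?thesis
      using 2 by (simp add: arrangements_tilde_def arrangements_0)
  next
    case 3
    then obtain u v where uv: "x = Suc u" "y = Suc v"
      by (metis gr0_implies_Suc)
    define a b where "a = real u" and "b = real v"
    have ab: "a \<ge> 0" "b \<ge> 0" "real c \<le> a + 1" "b + 1 \<le> 2 * real N"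
      using assms by (auto simp: a_def b_def uv)
    have "((b + 1) / (a + b + 2))\<^sup>2 * ((a + b + 1) * (a + b + 2) / ((a + 1) * (b + 1))) * (real c + 1)
        = (b + 1) * ((a + b + 1) / (a + b + 2)) * ((real c + 1) / (a + 1))"
      using ab by (simp add: divide_simps power2_eq_square)
    also have "\<dots> \<le> 2 * real N * 1 * 2"
      using ab by (intro mult_mono) (auto simp: divide_simps)
    finally have "((b + 1) / (a + b + 2))\<^sup>2 * ((a + b + 1) * (a + b + 2) / ((a + 1) * (b + 1))) * (real c + 1)
        \<le> 4 * real N"
      by simp
    from mult_left_mono[OF this less_imp_le[OF arrangements_pos[of u v]]]
    show ?thesis
      by (simp add: arrangements_tilde_def arrangements_add_both a_def b_def uv mult_ac add_ac)
  qed
qed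

text \<open>
  The factor \<open>sqrt (fact c / (4 * N) ^ c)\<close> compensates for the accumulated cost of \<open>c\<close> crossing edges,
  and each crossing edge is discounted by a further factor \<open>\<theta>\<close>, the parameter of an exponential
  Markov inequality.
\<close>

definition damping :: "nat \<Rightarrow> real \<Rightarrow> nat \<Rightarrow> real" where
  "damping N \<theta> c = \<theta> ^ c * sqrt (fact c / (4 * real N) ^ c)"

text \<open>
  The outcome without crossing contributes at most the current weight to the mean, and the crossing
  outcome at most a fraction \<open>\<theta>\<close> of it. In this way one inequality per step replaces the sum over all sets of times at which
  crossing edges can appear.
\<close>

lemma weighted_step:
  assumes "N > 0" "\<theta> \<ge> 0" "p \<ge> 0" "q \<ge> 0"
    and "p\<^sup>2 * v' \<le> v" "q\<^sup>2 * v'' * (real c + 1) \<le> v * (4 * real N)"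
  shows "p * (sqrt v' * damping N \<theta> c) + q * (sqrt v'' * damping N \<theta> (Suc c))
    \<le> (1 + \<theta>) * (sqrt v * damping N \<theta> c)"
proof -
  have stay: "p * sqrt v' \<le> sqrt v"
    using real_sqrt_le_mono[OF assms(5)] assms(3) by (simp add: real_sqrt_mult)
  let ?r = "fact c / (4 * real N) ^ c :: real"
  have eq: "q\<^sup>2 * v'' * (fact (Suc c) / (4 * real N) ^ Suc c)
      = q\<^sup>2 * v'' * (real c + 1) * (?r / (4 * real N))"
    by (simp add: algebra_simps)
  have "\<dots> \<le> v * (4 * real N) * (?r / (4 * real N))"
    using assms by (intro mult_right_mono) auto
  also have "\<dots> = v * ?r"
    using assms(1) by simp
  finally have "sqrt (q\<^sup>2 * v'' * (fact (Suc c) / (4 * real N) ^ Suc c)) \<le> sqrt (v * ?r)"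
    using eq by (simp only: real_sqrt_le_iff)
  then have switch: "q * sqrt v'' * sqrt (fact (Suc c) / (4 * real N) ^ Suc c) \<le> sqrt v * sqrt ?r"
    using assms(4) by (simp only: real_sqrt_mult real_sqrt_abs abs_of_nonneg)
  have "p * (sqrt v' * damping N \<theta> c) \<le> sqrt v * damping N \<theta> c"
    using mult_right_mono[OF stay, of "damping N \<theta> c"] assms(2) by (simp add: damping_def mult_ac)
  moreover have "q * (sqrt v'' * damping N \<theta> (Suc c)) \<le> \<theta> * (sqrt v * damping N \<theta> c)"
    using mult_left_mono[OF switch, of "\<theta> ^ Suc c"] assms(2)
    unfolding damping_def by (simp only: mult_ac power_Suc zero_le_power zero_le_mult_iff simp_thms)
  ultimately show ?thesis
    by (simp add: algebra_simps)
qed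

section \<open>The mean of the weight\<close>

lemma nn_integral_two_values:
  fixes P :: "nat pmf"
  assumes "finite S" "finite T" "S \<inter> T = {}" "set_pmf P \<subseteq> S \<union> T"
    and "\<And>i. i \<in> S \<Longrightarrow> f i = a" "\<And>i. i \<in> T \<Longrightarrow> f i = b" "a \<ge> 0" "b \<ge> 0"
  shows "(\<integral>\<^sup>+i. ennreal (f i) \<partial>measure_pmf P) = ennreal (sum (pmf P) S * a + sum (pmf P) T * b)"
proof -
  have "(\<integral>\<^sup>+i. ennreal (f i) \<partial>measure_pmf P) = (\<Sum>i\<in>S \<union> T. ennreal (f i) * ennreal (pmf P i))"
    using assms by (intro nn_integral_measure_pmf_support) auto
  also have "\<dots> = (\<Sum>i\<in>S \<union> T. ennreal (f i * pmf P i))"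
    using assms by (intro sum.cong) (auto simp: ennreal_mult)
  also have "\<dots> = ennreal (\<Sum>i\<in>S \<union> T. f i * pmf P i)"
    using assms by (intro sum_ennreal) auto
  also have "(\<Sum>i\<in>S \<union> T. f i * pmf P i) = (\<Sum>i\<in>S. f i * pmf P i) + (\<Sum>i\<in>T. f i * pmf P i)"
    using assms by (intro sum.union_disjoint) auto
  also have "(\<Sum>i\<in>S. f i * pmf P i) = sum (pmf P) S * a"
    using assms by (simp add: sum_distrib_left mult.commute)
  also have "(\<Sum>i\<in>T. f i * pmf P i) = sum (pmf P) T * b"
    using assms by (simp add: sum_distrib_left mult.commute)
  finally show ?thesis .
qed

lemma expectation_growth:
  fixes M :: "nat \<Rightarrow> 'g pmf" and W :: "'g \<Rightarrow> real"
  assumes "M (Suc 0) = return_pmf g" "W g \<le> 1" "\<theta> \<ge> 0"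
    and "\<And>t. M (Suc (Suc t)) = bind_pmf (M (Suc t)) (\<lambda>G. map_pmf (f (Suc t) G) (K (Suc t) G))"
    and "\<And>t G. Suc t < N \<Longrightarrow> G \<in> set_pmf (M (Suc t)) \<Longrightarrow>
      (\<integral>\<^sup>+i. ennreal (W (f (Suc t) G i)) \<partial>measure_pmf (K (Suc t) G)) \<le> ennreal ((1 + \<theta>) * W G)"
  shows "Suc t \<le> N \<Longrightarrow> (\<integral>\<^sup>+G. ennreal (W G) \<partial>measure_pmf (M (Suc t))) \<le> ennreal ((1 + \<theta>) ^ t)"
proof (induction t)
  case 0
  then show ?case
    using assms(1,2) by simp
next
  case (Suc t)
  have "(\<integral>\<^sup>+G. ennreal (W G) \<partial>measure_pmf (M (Suc (Suc t))))
      = (\<integral>\<^sup>+G. (\<integral>\<^sup>+i. ennreal (W (f (Suc t) G i)) \<partial>measure_pmf (K (Suc t) G)) \<partial>measure_pmf (M (Suc t)))"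
    by (simp add: assms(4))
  also have "\<dots> \<le> (\<integral>\<^sup>+G. ennreal (1 + \<theta>) * ennreal (W G) \<partial>measure_pmf (M (Suc t)))"
  proof (intro nn_integral_mono_AE AE_pmfI)
    fix G assume "G \<in> set_pmf (M (Suc t))"
    then have "(\<integral>\<^sup>+i. ennreal (W (f (Suc t) G i)) \<partial>measure_pmf (K (Suc t) G)) \<le> ennreal ((1 + \<theta>) * W G)"
      using assms(5) Suc.prems by simp
    then show "(\<integral>\<^sup>+i. ennreal (W (f (Suc t) G i)) \<partial>measure_pmf (K (Suc t) G))
        \<le> ennreal (1 + \<theta>) * ennreal (W G)"
      using assms(3) by (simp add: ennreal_mult')
  qed
  also have "\<dots> = ennreal (1 + \<theta>) * (\<integral>\<^sup>+G. ennreal (W G) \<partial>measure_pmf (M (Suc t)))"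
    by (intro nn_integral_cmult) simp
  also have "\<dots> \<le> ennreal (1 + \<theta>) * ennreal ((1 + \<theta>) ^ t)"
    using Suc by (intro mult_left_mono) auto
  also have "\<dots> = ennreal ((1 + \<theta>) ^ Suc t)"
    using assms(3) by (simp add: ennreal_mult')
  finally show ?case .
qed

lemma pmf_markov:
  fixes W :: "'g \<Rightarrow> real"
  assumes "(\<integral>\<^sup>+G. ennreal (W G) \<partial>measure_pmf M) \<le> ennreal B" "w > 0" "B \<ge> 0"
    and "\<And>G. G \<in> set_pmf M \<Longrightarrow> P G \<Longrightarrow> w \<le> W G"
  shows "measure_pmf.prob M {G. P G} \<le> B / w"
proof -
  have "ennreal w * emeasure (measure_pmf M) {G. P G} = (\<integral>\<^sup>+G. ennreal w * indicator {G. P G} G \<partial>measure_pmf M)"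
    by (simp add: nn_integral_cmult_indicator)
  also have "\<dots> \<le> (\<integral>\<^sup>+G. ennreal (W G) \<partial>measure_pmf M)"
    by (intro nn_integral_mono_AE AE_pmfI)
      (use assms(4) in \<open>auto simp: indicator_def intro!: ennreal_leI\<close>)
  finally have "ennreal (w * measure_pmf.prob M {G. P G}) \<le> ennreal B"
    using assms(1,2) by (simp add: measure_pmf.emeasure_eq_measure ennreal_mult)
  then show ?thesis
    using assms(2,3) by (simp add: field_simps)
qed

definition weight ::
  "(nat \<Rightarrow> nat \<Rightarrow> real) \<Rightarrow> (nat set \<Rightarrow> nat multigraph \<Rightarrow> nat) \<Rightarrow> nat set \<Rightarrow> nat set \<Rightarrow> nat \<Rightarrow> real \<Rightarrow>
    nat multigraph \<Rightarrow> real" where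
  "weight \<Phi> v S T N \<theta> G = sqrt (\<Phi> (v S G) (v T G)) * damping N \<theta> (cross S T G)"

text \<open>
  For both models it is enough to treat a new mini-vertex on the side \<open>S\<close>, because the weight is
  symmetric in the two sides. Only the probabilities of the two outcomes and the potential \<open>\<Phi>\<close> are
  specific to a model.
\<close>

lemma weight_attach:
  assumes "splits N S T" "N > 0" "\<theta> \<ge> 0" "Suc t \<in> S" "set_pmf P \<subseteq> {1..N}"
    and "\<And>x y. \<Phi> x y \<ge> 0"
    and v: "\<And>i. v S (attach t G i) = v S G + 1 + of_bool (i \<in> S)"
      "\<And>i. v T (attach t G i) = v T G + of_bool (i \<in> T)"
    and stay: "(sum (pmf P) S)\<^sup>2 * \<Phi> (Suc (Suc (v S G))) (v T G) \<le> \<Phi> (v S G) (v T G)"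
    and switch: "(sum (pmf P) T)\<^sup>2 * \<Phi> (Suc (v S G)) (Suc (v T G)) * (real (cross S T G) + 1)
      \<le> \<Phi> (v S G) (v T G) * (4 * real N)"
  shows "(\<integral>\<^sup>+i. ennreal (weight \<Phi> v S T N \<theta> (attach t G i)) \<partial>measure_pmf P)
    \<le> ennreal ((1 + \<theta>) * weight \<Phi> v S T N \<theta> G)"
proof -
  let ?c = "cross S T G"
  let ?a = "sqrt (\<Phi> (Suc (Suc (v S G))) (v T G)) * damping N \<theta> ?c"
  let ?b = "sqrt (\<Phi> (Suc (v S G)) (Suc (v T G))) * damping N \<theta> (Suc ?c)"
  have disj: "i \<in> S \<Longrightarrow> i \<notin> T" for i
    using assms(1) by (auto simp: splits_def)
  have "weight \<Phi> v S T N \<theta> (attach t G i) = ?a" if "i \<in> S" for i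
    using that disj[OF that] cross_attach[OF assms(1,4), of i G] by (simp add: weight_def v)
  moreover have "weight \<Phi> v S T N \<theta> (attach t G i) = ?b" if "i \<in> T" for i
    using that disj[of i] cross_attach[OF assms(1,4), of i G] by (auto simp: weight_def v)
  ultimately have "(\<integral>\<^sup>+i. ennreal (weight \<Phi> v S T N \<theta> (attach t G i)) \<partial>measure_pmf P)
      = ennreal (sum (pmf P) S * ?a + sum (pmf P) T * ?b)"
    using assms(1,3,5,6) splits_finite[OF assms(1)]
    by (intro nn_integral_two_values) (auto simp: splits_def damping_def)
  also have "\<dots> \<le> ennreal ((1 + \<theta>) * weight \<Phi> v S T N \<theta> G)"
    unfolding weight_def
    using assms(2,3) stay switch by (intro ennreal_leI weighted_step sum_nonneg) auto
  finally show ?thesis .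
qed

lemma weight_expectation:
  assumes "M (Suc 0) = return_pmf initial_graph"
    and "\<And>t. M (Suc (Suc t)) = bind_pmf (M (Suc t)) (\<lambda>G. map_pmf (attach (Suc t) G) (K (Suc t) G))"
    and grown: "\<And>t G. G \<in> set_pmf (M (Suc t)) \<Longrightarrow> grown (Suc t) G"
    and sym: "\<And>x y. \<Phi> x y = \<Phi> y x"
    and init: "weight \<Phi> v S T N \<theta> initial_graph \<le> 1"
    and drift: "\<And>S T t G. splits N S T \<Longrightarrow> grown t G \<Longrightarrow> t \<ge> 1 \<Longrightarrow> Suc t \<le> N \<Longrightarrow> Suc t \<in> S \<Longrightarrow>
      (\<integral>\<^sup>+i. ennreal (weight \<Phi> v S T N \<theta> (attach t G i)) \<partial>measure_pmf (K t G))
        \<le> ennreal ((1 + \<theta>) * weight \<Phi> v S T N \<theta> G)"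
    and "splits N S T" "\<theta> \<ge> 0" "N \<ge> 1"
  shows "(\<integral>\<^sup>+G. ennreal (weight \<Phi> v S T N \<theta> G) \<partial>measure_pmf (M N)) \<le> ennreal ((1 + \<theta>) ^ N)"
proof -
  obtain t where t: "N = Suc t"
    using assms(9) by (metis One_nat_def Suc_le_D)
  have swap: "weight \<Phi> v T S N \<theta> H = weight \<Phi> v S T N \<theta> H" for H
    unfolding weight_def using sym cross_commute by metis
  have "(\<integral>\<^sup>+G. ennreal (weight \<Phi> v S T N \<theta> G) \<partial>measure_pmf (M (Suc t))) \<le> ennreal ((1 + \<theta>) ^ t)"
  proof (rule expectation_growth[where f = attach and K = K and N = N and g = initial_graph])
    fix s G assume s: "Suc s < N" "G \<in> set_pmf (M (Suc s))"
    have "Suc (Suc s) \<in> S \<or> Suc (Suc s) \<in> T"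
      using s assms(7) by (auto simp: splits_def)
    then show "(\<integral>\<^sup>+i. ennreal (weight \<Phi> v S T N \<theta> (attach (Suc s) G i)) \<partial>measure_pmf (K (Suc s) G))
        \<le> ennreal ((1 + \<theta>) * weight \<Phi> v S T N \<theta> G)"
    proof
      assume "Suc (Suc s) \<in> S"
      then show ?thesis
        using drift[OF assms(7) grown[OF s(2)]] s(1) by simp
    next
      assume "Suc (Suc s) \<in> T"
      then show ?thesis
        using drift[OF splits_commute[OF assms(7)] grown[OF s(2)]] s(1) by (simp add: swap)
    qed
  qed (use assms t in auto)
  also have "\<dots> \<le> ennreal ((1 + \<theta>) ^ N)"
    using assms(8) t by (intro ennreal_leI power_increasing) auto
  finally show ?thesis
    using t by simp
qed

lemma arrangements_tilde_nonneg: "arrangements_tilde x y \<ge> 0"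
  using arrangements_pos[of "x - 1" "y - 1"] by (simp add: arrangements_tilde_def)

lemma arrangements_tilde_commute: "arrangements_tilde x y = arrangements_tilde y x"
  by (simp add: arrangements_tilde_def arrangements_commute)

lemma initial_cross:
  assumes "splits N S T"
  shows "cross S T initial_graph = 0"
  using assms by (auto simp: cross_def initial_graph_def splits_def)

lemma weight_drift:
  assumes "splits N S T" "grown t G" "t \<ge> 1" "Suc t \<le> N" "Suc t \<in> S" "\<theta> \<ge> 0"
  shows "(\<integral>\<^sup>+i. ennreal (weight arrangements vol S T N \<theta> (attach t G i)) \<partial>measure_pmf (target t G))
    \<le> ennreal ((1 + \<theta>) * weight arrangements vol S T N \<theta> G)"
proof -
  have fin: "finite S" "finite T"
    using splits_finite[OF assms(1)] by auto
  have sum: "vol S G + vol T G = 2 * t"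
    using grown_half_edges[OF assms(2,1)] assms(4) by simp
  then have sumr: "real (vol S G) + real (vol T G) = 2 * real t"
    by linarith
  have c: "cross S T G \<le> vol S G"
    using grown_cross_le(1)[OF assms(2,1)] assms(4) by simp
  have notT: "Suc t \<notin> T"
    using assms(1,5) by (auto simp: splits_def)
  have pmf: "pmf (target t G) i = (real (deg G i) + of_bool (i = Suc t)) / (2 * real t + 1)"
    if "i \<in> S \<union> T" for i
    using that assms(1) grown_deg_unborn[OF assms(2), of i]
    by (auto simp: pmf_target_wf[OF grown_wf_at[OF assms(2)]] splits_def)
  have S: "sum (pmf (target t G)) S = (real (vol S G) + 1) / (real (vol S G) + real (vol T G) + 1)"
    unfolding sumr using pmf assms(5) fin
    by (simp add: vol_def sum.distrib of_bool_def add_divide_distrib flip: sum_divide_distrib)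
  have T: "sum (pmf (target t G)) T = real (vol T G) / (real (vol S G) + real (vol T G) + 1)"
    unfolding sumr using pmf notT fin
    by (simp add: vol_def sum.distrib of_bool_def add_divide_distrib flip: sum_divide_distrib)
  show ?thesis
  proof (rule weight_attach[OF assms(1) _ assms(6,5)])
    show "set_pmf (target t G) \<subseteq> {1..N}"
      using assms(4) by (auto simp: set_pmf_eq pmf_target_wf[OF grown_wf_at[OF assms(2)]] split: if_splits)
    show "(sum (pmf (target t G)) S)\<^sup>2 * arrangements (Suc (Suc (vol S G))) (vol T G)
        \<le> arrangements (vol S G) (vol T G)"
      unfolding S by (rule arrangements_stay)
    show "(sum (pmf (target t G)) T)\<^sup>2 * arrangements (Suc (vol S G)) (Suc (vol T G)) * (real (cross S T G) + 1)
        \<le> arrangements (vol S G) (vol T G) * (4 * real N)"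
      unfolding T using sum assms(4) c by (intro arrangements_switch) auto
  qed (use assms(4,5) notT fin arrangements_pos in \<open>auto simp: vol_attach less_imp_le\<close>)
qed

lemma weight_expectation_mini_tree:
  assumes "splits N S T" "\<theta> \<ge> 0" "N \<ge> 1"
  shows "(\<integral>\<^sup>+G. ennreal (weight arrangements vol S T N \<theta> G) \<partial>measure_pmf (mini_tree N))
    \<le> ennreal ((1 + \<theta>) ^ N)"
proof (rule weight_expectation[where K = target])
  have "1 \<in> S \<longleftrightarrow> 1 \<notin> T"
    using assms(1,3) by (auto simp: splits_def)
  then show "weight arrangements vol S T N \<theta> initial_graph \<le> 1"
    using splits_finite[OF assms(1)] initial_cross[OF assms(1)]
    by (auto simp: weight_def vol_initial damping_def arrangements_def)
  show "arrangements x y = arrangements y x" for x y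
    by (rule arrangements_commute)
qed (use assms weight_drift grown_mini_tree in auto)

text \<open>The subtraction is exact on all reachable graphs, since mini-vertex 1 carries a loop.\<close>

definition vol_tilde :: "nat set \<Rightarrow> nat multigraph \<Rightarrow> nat" where
  "vol_tilde S G = vol S G - of_bool (1 \<in> S)"

lemma vol_tilde_sum:
  assumes "grown t G" "finite S"
  shows "vol_tilde S G = (\<Sum>s\<in>S. deg_tilde G s)"
proof (cases "1 \<in> S")
  case True
  have deg1: "deg G 1 \<ge> 1"
    using grown_wf_at[OF assms(1)] by (auto simp: wf_at_def deg_def dest!: multi_member_split)
  have "(\<Sum>s\<in>S. deg_tilde G s) = (deg G 1 - 1) + (\<Sum>s\<in>S - {1}. deg_tilde G s)"
    using True assms(2) by (subst sum.remove[of S 1]) (auto simp: deg_tilde_def)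
  also have "(\<Sum>s\<in>S - {1}. deg_tilde G s) = (\<Sum>s\<in>S - {1}. deg G s)"
    by (intro sum.cong) (auto simp: deg_tilde_def)
  finally show ?thesis
    using deg1 True assms(2) by (simp add: vol_tilde_def vol_def sum.remove[of S 1])
next
  case False
  then show ?thesis
    by (auto simp: vol_tilde_def vol_def deg_tilde_def intro!: sum.cong)
qed

lemma weight_tilde_drift:
  assumes "splits N S T" "grown t G" "t \<ge> 1" "Suc t \<le> N" "Suc t \<in> S" "\<theta> \<ge> 0"
  shows "(\<integral>\<^sup>+i. ennreal (weight arrangements_tilde vol_tilde S T N \<theta> (attach t G i)) \<partial>measure_pmf (target_tilde t G))
    \<le> ennreal ((1 + \<theta>) * weight arrangements_tilde vol_tilde S T N \<theta> G)"
proof -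
  have fin: "finite S" "finite T"
    using splits_finite[OF assms(1)] by auto
  have one: "1 \<in> S \<longleftrightarrow> 1 \<notin> T"
    using assms(1,4) by (auto simp: splits_def)
  have sum: "vol S G + vol T G = 2 * t"
    using grown_half_edges[OF assms(2,1)] assms(4) by simp
  have cS: "cross S T G + of_bool (1 \<in> S) \<le> vol S G"
    using grown_cross_le(1)[OF assms(2,1)] assms(4) by simp
  have cT: "of_bool (1 \<in> T) \<le> vol T G"
    using grown_cross_le(1)[OF assms(2) splits_commute[OF assms(1)]] assms(4) by simp
  have sum': "vol_tilde S G + vol_tilde T G = 2 * t - 1"
    using one sum cS cT by (auto simp: vol_tilde_def)
  have sumr: "real (vol_tilde S G) + real (vol_tilde T G) = 2 * real t - 1"
    using sum' assms(3) by linarith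
  have notT: "Suc t \<notin> T"
    using assms(1,5) by (auto simp: splits_def)
  have pmf: "pmf (target_tilde t G) i = real (deg_tilde G i) / (2 * real t - 1)"
    if "i \<in> S \<union> T" for i
    using that assms(1) grown_deg_unborn[OF assms(2), of i]
    by (auto simp: pmf_target_tilde_wf[OF grown_wf_at[OF assms(2)] assms(3)] splits_def deg_tilde_def)
  have S: "sum (pmf (target_tilde t G)) S
      = real (vol_tilde S G) / (real (vol_tilde S G) + real (vol_tilde T G))"
    unfolding sumr using pmf fin by (simp add: vol_tilde_sum[OF assms(2)] flip: sum_divide_distrib)
  have T: "sum (pmf (target_tilde t G)) T
      = real (vol_tilde T G) / (real (vol_tilde S G) + real (vol_tilde T G))"
    unfolding sumr using pmf fin by (simp add: vol_tilde_sum[OF assms(2)] flip: sum_divide_distrib)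
  show ?thesis
  proof (rule weight_attach[OF assms(1) _ assms(6,5)])
    show "set_pmf (target_tilde t G) \<subseteq> {1..N}"
      using target_tilde_old[OF assms(2,3)] assms(4) by fastforce
    show "(sum (pmf (target_tilde t G)) S)\<^sup>2 * arrangements_tilde (Suc (Suc (vol_tilde S G))) (vol_tilde T G)
        \<le> arrangements_tilde (vol_tilde S G) (vol_tilde T G)"
      unfolding S by (rule arrangements_tilde_stay)
    show "(sum (pmf (target_tilde t G)) T)\<^sup>2 * arrangements_tilde (Suc (vol_tilde S G)) (Suc (vol_tilde T G))
          * (real (cross S T G) + 1)
        \<le> arrangements_tilde (vol_tilde S G) (vol_tilde T G) * (4 * real N)"
      unfolding T using sum' assms(3,4) cS by (intro arrangements_tilde_switch) (auto simp: vol_tilde_def)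
    show "vol_tilde S (attach t G i) = vol_tilde S G + 1 + of_bool (i \<in> S)" for i
      using assms(5) fin cS by (simp add: vol_tilde_def vol_attach)
    show "vol_tilde T (attach t G i) = vol_tilde T G + of_bool (i \<in> T)" for i
      using notT fin cT by (simp add: vol_tilde_def vol_attach)
  qed (use assms(4) arrangements_tilde_nonneg in auto)
qed

lemma weight_expectation_mini_tree_tilde:
  assumes "splits N S T" "\<theta> \<ge> 0" "N \<ge> 1"
  shows "(\<integral>\<^sup>+G. ennreal (weight arrangements_tilde vol_tilde S T N \<theta> G) \<partial>measure_pmf (mini_tree_tilde N))
    \<le> ennreal ((1 + \<theta>) ^ N)"
proof (rule weight_expectation[where K = target_tilde])
  have "1 \<in> S \<longleftrightarrow> 1 \<notin> T"
    using assms(1,3) by (auto simp: splits_def)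
  then show "weight arrangements_tilde vol_tilde S T N \<theta> initial_graph \<le> 1"
    using splits_finite[OF assms(1)] initial_cross[OF assms(1)]
    by (auto simp: weight_def vol_tilde_def vol_initial damping_def arrangements_tilde_def arrangements_def)
  show "arrangements_tilde x y = arrangements_tilde y x" for x y
    by (rule arrangements_tilde_commute)
qed (use assms weight_tilde_drift grown_mini_tree_tilde in auto)

section \<open>Binomial estimates\<close>

text \<open>
  Choosing \<open>k\<close> out of \<open>n\<close> elements in each of \<open>h\<close> groups is one way to choose \<open>h * k\<close> out of
  \<open>h * n\<close>. The estimate has no polynomial loss, unlike one by Stirling's formula.
\<close>

lemma binomial_power_le: "(n choose k) ^ h \<le> (h * n) choose (h * k)"
proof (induction h)
  case (Suc h)
  have "(n choose k) ^ Suc h \<le> (n choose k) * ((h * n) choose (h * k))"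
    using Suc by simp
  also have "\<dots> = (n choose k) * ((h * n) choose (Suc h * k - k))"
    by simp
  also have "\<dots> \<le> (\<Sum>j\<le>Suc h * k. (n choose j) * ((h * n) choose (Suc h * k - j)))"
    by (intro member_le_sum) auto
  also have "\<dots> = (n + h * n) choose (Suc h * k)"
    by (rule vandermonde)
  finally show ?case
    by simp
qed simp

lemma binomial_central_le:
  assumes "j \<le> i" "i + j \<le> n"
  shows "n choose j \<le> n choose i"
proof (cases "2 * i \<le> n")
  case True
  then show ?thesis
    using assms binomial_mono by simp
next
  case False
  then have "n choose j \<le> n choose (n - i)"
    using assms by (intro binomial_mono) auto
  also have "\<dots> = n choose i"
    using assms False by (cases "i \<le> n") (auto simp: binomial_symmetric[of i n])
  finally show ?thesis .
qed

lemma binomial_drop: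
  assumes "c \<le> m" "m > 0" "n > 0"
  shows "real (n choose (2 * m)) * (real m / real n) ^ c \<le> real (n choose (2 * m - c))"
  using assms(1)
proof (induction c)
  case (Suc c)
  define j where "j = 2 * m - Suc c"
  have j: "2 * m - c = Suc j" "m \<le> Suc j"
    using Suc.prems assms(2) by (auto simp: j_def)
  have "Suc j * (n choose Suc j) = (n - j) * (n choose j)"
    using binomial_absorption[of j n] binomial_absorb_comp[of n j] by simp
  also have "\<dots> \<le> n * (n choose j)"
    by simp
  finally have "Suc j * (n choose Suc j) \<le> n * (n choose j)" .
  then have "m * (n choose Suc j) \<le> n * (n choose j)"
    using j(2) by (meson le_trans mult_le_mono1)
  then have "real m * real (n choose Suc j) \<le> real n * real (n choose j)"
    by (metis of_nat_le_iff of_nat_mult)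
  then have step: "real (n choose Suc j) * (real m / real n) \<le> real (n choose j)"
    using assms(3) by (simp add: field_simps)
  have "real (n choose (2 * m)) * (real m / real n) ^ Suc c
      \<le> real (n choose (2 * m - c)) * (real m / real n)"
    using mult_right_mono[OF Suc.IH, of "real m / real n"] Suc.prems by (simp add: mult_ac)
  also have "\<dots> \<le> real (n choose j)"
    using step by (simp add: j)
  finally show ?case
    by (simp add: j_def)
qed simp

lemma binomial_shrink3:
  assumes "2 * (j + 2) < n + 3"
  shows "(n + 3) choose (j + 2) \<le> 2 * (n + 3)\<^sup>2 * (n choose j)"
proof -
  have up: "Suc n choose Suc j \<le> Suc n * (n choose j)" for n j
    using Suc_times_binomial[of j n] by (metis le_add1 mult_le_mono1 nat_mult_1 plus_1_eq_Suc)
  have "(n + 3) choose (j + 2) = (Suc (Suc n) choose Suc (Suc j)) + (Suc (Suc n) choose Suc j)"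
    by (simp add: numeral_eq_Suc)
  also have "\<dots> \<le> 2 * (Suc (Suc n) choose Suc (Suc j))"
    using binomial_mono[of "Suc j" "Suc (Suc j)" "Suc (Suc n)"] assms by simp
  also have "\<dots> \<le> 2 * (Suc (Suc n) * (Suc n * (n choose j)))"
    using up[of "Suc n" "Suc j"] up[of n j] by (meson le_trans mult_le_mono2)
  also have "\<dots> \<le> 2 * ((n + 3) * ((n + 3) * (n choose j)))"
    by (intro mult_le_mono) auto
  finally show ?thesis
    by (simp add: power2_eq_square mult_ac)
qed

text \<open>
  The left side increases in \<open>c\<close> up to \<open>Y\<close>, so \<open>c = \<mu>\<close> is the extreme case. Comparison with a single
  term of the exponential series at \<open>\<mu>\<close> avoids monotonicity in a discrete variable and Stirling's
  formula.
\<close>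

lemma power_div_fact_le:
  fixes \<mu> Y :: real
  assumes "0 < \<mu>" "\<mu> \<le> Y" "real c \<le> \<mu>"
  shows "Y ^ c / fact c \<le> (exp 1 * Y / \<mu>) powr \<mu>"
proof -
  have "Y ^ c / fact c = (Y / \<mu>) ^ c * (\<mu> ^ c / fact c)"
    using assms by (simp add: power_divide)
  also have "\<dots> \<le> (Y / \<mu>) powr \<mu> * exp \<mu>"
  proof (intro mult_mono)
    have "(Y / \<mu>) ^ c = (Y / \<mu>) powr real c"
      using assms by (simp add: powr_realpow)
    also have "\<dots> \<le> (Y / \<mu>) powr \<mu>"
      using assms by (intro powr_mono) auto
    finally show "(Y / \<mu>) ^ c \<le> (Y / \<mu>) powr \<mu>" .
    have "(\<lambda>n. \<mu> ^ n / fact n) sums exp \<mu>"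
      using exp_converges[of \<mu>] by (simp add: divide_inverse mult.commute)
    from sum_le_suminf[OF sums_summable[OF this], of "{c}"] sums_unique[OF this]
    show "\<mu> ^ c / fact c \<le> exp \<mu>"
      using assms by simp
  qed (use assms in auto)
  also have "\<dots> = (exp 1 * Y / \<mu>) powr \<mu>"
    using assms by (simp add: powr_mult exp_powr_real powr_divide)
  finally show ?thesis .
qed

section \<open>Sparse cuts along a fixed set\<close>

text \<open>
  Markov's inequality for a weight of mean at most \<open>(1 + \<theta>) ^ N\<close>. The choice \<open>\<theta> = \<mu> / N\<close> bounds the
  mean by \<open>exp \<mu>\<close>. On the event that fewer than \<open>\<mu>\<close> edges cross, the potential is at least \<open>D\<^sup>2 / \<kappa>\<close>
  up to a factor \<open>(m / (2 * N)) ^ c\<close>; this factor and the damping together are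
  \<open>sqrt (fact c / Y ^ c)\<close> with \<open>Y = 8 * N ^ 4 / (m * \<mu>\<^sup>2)\<close>. The second conclusion sharpens the first
  when only \<open>c = 0\<close> is possible: then no factor depending on \<open>N / m\<close> is lost.
\<close>

lemma weighted_tail:
  fixes Q :: "'g \<Rightarrow> real" and c :: "'g \<Rightarrow> nat" and a :: real
  assumes "0 < a" "a \<le> 1" "0 < m" "m \<le> N" "D > 0" "\<kappa> > 0"
    and mu: "\<mu> = a * real m"
    and mean: "(\<integral>\<^sup>+G. ennreal (sqrt (Q G) * damping N (\<mu> / real N) (c G)) \<partial>measure_pmf M)
      \<le> ennreal ((1 + \<mu> / real N) ^ N)"
    and low: "\<And>G. G \<in> set_pmf M \<Longrightarrow> real (c G) < \<mu> \<Longrightarrow>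
      D\<^sup>2 * (real m / real (2 * N)) ^ c G / \<kappa> \<le> Q G"
  shows "measure_pmf.prob M {G. real (c G) < \<mu>}
      \<le> sqrt \<kappa> / D * ((2 * exp 1 / a) ^ 3 * (real N / real m) ^ 4) powr (\<mu> / 2)" (is ?general)
    and "\<mu> \<le> 1 \<Longrightarrow> measure_pmf.prob M {G. real (c G) < \<mu>} \<le> exp 1 * sqrt \<kappa> / D"
proof -
  define \<theta> where "\<theta> = \<mu> / real N"
  \<comment> \<open>\<open>1 / Y\<close> collects what one crossing edge costs in the square of the weight.\<close>
  define Y where "Y = 8 * real N ^ 4 / (real m * \<mu>\<^sup>2)"
  have N: "real N > 0" "real m > 0" "real m \<le> real N"
    using assms by auto
  have mu_pos: "\<mu> > 0" "\<mu> \<le> real m"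
    using assms by (auto simp: mult_le_cancel_right1)
  have theta: "\<theta> > 0"
    using mu_pos N by (simp add: \<theta>_def)
  have "\<mu> * (real m * \<mu>\<^sup>2) \<le> real N * (real N * (real N)\<^sup>2)"
    using mu_pos N by (intro mult_mono power_mono) auto
  also have "\<dots> \<le> 8 * real N ^ 4"
    by (simp add: power_def numeral_eq_Suc)
  finally have Y: "\<mu> \<le> Y"
    using N mu_pos by (simp add: Y_def pos_le_divide_eq)
  have growth: "(1 + \<theta>) ^ N \<le> exp \<mu>"
  proof -
    have "(1 + \<theta>) ^ N \<le> exp \<theta> ^ N"
      using theta by (intro power_mono) (auto simp: add.commute)
    also have "\<dots> = exp \<mu>"
      using N by (simp add: \<theta>_def flip: exp_of_nat_mult)
    finally show ?thesis .
  qed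
  have weight: "D / sqrt \<kappa> * sqrt (fact (c G) / Y ^ c G) \<le> sqrt (Q G) * damping N \<theta> (c G)"
    if "G \<in> set_pmf M" "real (c G) < \<mu>" for G
  proof -
    let ?c = "c G"
    have "1 / Y = real m / real (2 * N) * \<theta>\<^sup>2 / (4 * real N)"
      using N mu_pos by (simp add: Y_def \<theta>_def field_simps power_def numeral_eq_Suc)
    then have "(1 / Y) ^ ?c = (real m / real (2 * N)) ^ ?c * (\<theta>\<^sup>2) ^ ?c / (4 * real N) ^ ?c"
      by (simp only: power_mult_distrib power_divide)
    then have "fact ?c * (1 / Y) ^ ?c
        = (real m / real (2 * N)) ^ ?c * (\<theta> ^ ?c)\<^sup>2 * (fact ?c / (4 * real N) ^ ?c)"
      by (simp only: power_mult[symmetric] mult.commute[of ?c 2]) (simp only: mult_ac times_divide_eq_right)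
    then have "fact ?c / Y ^ ?c
        = (real m / real (2 * N)) ^ ?c * (\<theta> ^ ?c)\<^sup>2 * (fact ?c / (4 * real N) ^ ?c)"
      by (simp only: divide_inverse mult_1_left power_inverse)
    then have "D / sqrt \<kappa> * sqrt (fact ?c / Y ^ ?c)
        = sqrt (D\<^sup>2 * (real m / real (2 * N)) ^ ?c / \<kappa>) * (\<theta> ^ ?c * sqrt (fact ?c / (4 * real N) ^ ?c))"
      using assms(5) theta by (simp add: real_sqrt_mult real_sqrt_divide)
    also have "\<dots> \<le> sqrt (Q G) * (\<theta> ^ ?c * sqrt (fact ?c / (4 * real N) ^ ?c))"
      using low[OF that] theta by (intro mult_right_mono) auto
    finally show ?thesis
      by (simp add: damping_def)
  qed
  define B where "B = exp 1 * Y / \<mu>"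
  have B: "B > 0"
    using Y mu_pos by (simp add: B_def)
  define w where "w = D / sqrt \<kappa> * B powr (- \<mu> / 2)"
  have w: "w > 0"
    using assms B by (simp add: w_def)
  have "w \<le> sqrt (Q G) * damping N \<theta> (c G)" if "G \<in> set_pmf M" "real (c G) < \<mu>" for G
  proof -
    have "Y ^ c G / fact (c G) \<le> B powr \<mu>"
      unfolding B_def using mu_pos Y that by (intro power_div_fact_le) auto
    then have "B powr (- \<mu>) \<le> fact (c G) / Y ^ c G"
      using B Y mu_pos by (simp add: powr_minus field_simps)
    moreover have "sqrt (B powr (- \<mu>)) = B powr (- \<mu> / 2)"
      using B by (simp add: powr_half_sqrt[symmetric] powr_powr)
    ultimately have "B powr (- \<mu> / 2) \<le> sqrt (fact (c G) / Y ^ c G)"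
      by (metis real_sqrt_le_iff)
    then have "w \<le> D / sqrt \<kappa> * sqrt (fact (c G) / Y ^ c G)"
      unfolding w_def using assms by (intro mult_left_mono) auto
    then show ?thesis
      using weight[OF that] by simp
  qed
  then have "measure_pmf.prob M {G. real (c G) < \<mu>} \<le> (1 + \<theta>) ^ N / w"
    using mean theta w by (intro pmf_markov) (auto simp: \<theta>_def)
  also have "\<dots> \<le> exp \<mu> / w"
    using growth w by (simp add: divide_right_mono)
  also have "\<dots> = sqrt \<kappa> / D * (exp \<mu> * B powr (\<mu> / 2))"
    using B by (simp add: w_def powr_minus field_simps)
  also have "exp \<mu> = exp 2 powr (\<mu> / 2)"
    by (simp add: exp_powr_real)
  also have "exp 2 powr (\<mu> / 2) * B powr (\<mu> / 2) = (exp 2 * B) powr (\<mu> / 2)"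
    using B by (simp add: powr_mult)
  also have "exp 2 * B = (2 * exp 1 / a) ^ 3 * (real N / real m) ^ 4"
  proof -
    have "exp 2 * (exp 1 :: real) = exp 1 ^ 3"
      by (simp flip: exp_add exp_of_nat_mult)
    then have "exp 2 * B = exp 1 ^ 3 * (Y / \<mu>)"
      by (simp add: B_def)
    also have "Y / \<mu> = 8 / a ^ 3 * (real N / real m) ^ 4"
      using N assms(1) by (simp add: Y_def mu field_simps power_def numeral_eq_Suc)
    finally show ?thesis
      by (simp add: power_divide power_mult_distrib)
  qed
  finally show ?general .
  show "measure_pmf.prob M {G. real (c G) < \<mu>} \<le> exp 1 * sqrt \<kappa> / D" if "\<mu> \<le> 1"
  proof -
    have "D / sqrt \<kappa> \<le> sqrt (Q G) * damping N \<theta> (c G)" if "G \<in> set_pmf M" "real (c G) < \<mu>" for G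
    proof -
      have "c G = 0"
        using that(2) \<open>\<mu> \<le> 1\<close> by linarith
      then show ?thesis
        using weight[OF that] by simp
    qed
    then have "measure_pmf.prob M {G. real (c G) < \<mu>} \<le> (1 + \<theta>) ^ N / (D / sqrt \<kappa>)"
      using mean theta assms by (intro pmf_markov) (auto simp: \<theta>_def)
    also have "\<dots> \<le> exp 1 / (D / sqrt \<kappa>)"
    proof (intro divide_right_mono)
      show "(1 + \<theta>) ^ N \<le> exp 1"
        using growth that by (smt (verit) exp_le_cancel_iff)
    qed (use assms in auto)
    finally show ?thesis
      by simp
  qed
qed

text \<open>
  The final volume of \<open>S\<close> is within \<open>c\<close> of \<open>2 * m\<close>, and its distance to either end of the row \<open>2 * N\<close>
  of Pascal's triangle is at least \<open>2 * m - c\<close>, because \<open>S\<close> is the smaller side.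
\<close>

lemma arrangements_final:
  assumes "grown N G" "splits N S T" "card S = m" "0 < m" "2 * m \<le> N" "cross S T G \<le> m"
  shows "real ((2 * N) choose (2 * m)) * (real m / real (2 * N)) ^ cross S T G
    \<le> arrangements (vol S G) (vol T G)"
proof -
  let ?c = "cross S T G"
  have ST: "S \<inter> {1..N} = S" "T \<inter> {1..N} = T" "card S + card T = N"
    using assms(2) splits_finite[OF assms(2)] card_Un_disjoint[of S T] by (auto simp: splits_def)
  have vol: "vol S G + vol T G = 2 * N" "2 * m \<le> vol S G + ?c" "2 * (N - m) \<le> vol T G + ?c"
    using grown_half_edges[OF assms(1,2)] grown_cross_le(2)[OF assms(1,2)] ST assms(3)
      grown_cross_le(2)[OF assms(1) splits_commute[OF assms(2)]] by (auto simp: cross_commute)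
  have "real ((2 * N) choose (2 * m)) * (real m / real (2 * N)) ^ ?c \<le> real ((2 * N) choose (2 * m - ?c))"
    using assms by (intro binomial_drop) auto
  also have "\<dots> \<le> arrangements (vol S G) (vol T G)"
    unfolding arrangements_def vol(1) of_nat_le_iff
    using vol assms(5,6) by (intro binomial_central_le) auto
  finally show ?thesis .
qed

text \<open>
  The shifted volumes lie three rows higher in Pascal's triangle, which costs a factor quadratic in
  \<open>N\<close>. A crossing edge is needed to keep both shifted volumes nonnegative and the entry to the left of
  the centre.
\<close>

lemma arrangements_tilde_final:
  assumes "grown N G" "splits N S T" "card S = m" "2 \<le> m" "2 * m \<le> N"
    and "1 \<le> cross S T G" "cross S T G \<le> m"
  shows "real ((2 * N) choose (2 * m)) * (real m / real (2 * N)) ^ cross S T G / (8 * (real N)\<^sup>2)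
    \<le> arrangements_tilde (vol_tilde S G) (vol_tilde T G)"
proof -
  let ?c = "cross S T G"
  have ST: "S \<inter> {1..N} = S" "T \<inter> {1..N} = T" "card S + card T = N"
    using assms(2) splits_finite[OF assms(2)] card_Un_disjoint[of S T] by (auto simp: splits_def)
  have one: "1 \<in> S \<longleftrightarrow> 1 \<notin> T"
    using assms(2,4,5) by (auto simp: splits_def)
  have vol: "vol S G + vol T G = 2 * N" "2 * m \<le> vol S G + ?c" "2 * (N - m) \<le> vol T G + ?c"
      "?c + of_bool (1 \<in> S) \<le> vol S G" "?c + of_bool (1 \<in> T) \<le> vol T G"
    using grown_half_edges[OF assms(1,2)] grown_cross_le[OF assms(1,2)] ST assms(3)
      grown_cross_le[OF assms(1) splits_commute[OF assms(2)]] by (auto simp: cross_commute)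
  define j where "j = 2 * m - ?c - 2"
  have j: "2 * m - ?c = j + 2"
    using assms by (simp add: j_def)
  have "3 \<le> 2 * N"
    using assms(4,5) by linarith
  then obtain p where p: "2 * N = p + 3"
    by (metis add.commute le_iff_add)
  have tilde: "vol_tilde S G - 1 + (vol_tilde T G - 1) = p" "j \<le> vol_tilde S G - 1" "j \<le> vol_tilde T G - 1"
    using vol one p j assms(4-7) by (auto simp: vol_tilde_def of_bool_def split: if_splits)
  have "real ((2 * N) choose (2 * m)) * (real m / real (2 * N)) ^ ?c \<le> real ((2 * N) choose (2 * m - ?c))"
    using assms by (intro binomial_drop) auto
  also have "\<dots> \<le> real (2 * (2 * N)\<^sup>2 * (p choose j))"
    unfolding p j of_nat_le_iff using j p assms(5-7) by (intro binomial_shrink3) auto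
  also have "\<dots> \<le> real (2 * (2 * N)\<^sup>2 * (p choose (vol_tilde S G - 1)))"
    unfolding of_nat_le_iff using tilde by (intro mult_left_mono binomial_central_le) auto
  also have "\<dots> = 8 * (real N)\<^sup>2 * arrangements_tilde (vol_tilde S G) (vol_tilde T G)"
    unfolding arrangements_tilde_def arrangements_def tilde(1) by (simp add: power2_eq_square)
  finally show ?thesis
    using assms(4,5) by (simp add: pos_divide_le_eq mult_ac)
qed

text \<open>
  The first case is the one in which a sparse cut has no edges at all.
\<close>

definition tail_bound :: "real \<Rightarrow> nat \<Rightarrow> nat \<Rightarrow> nat \<Rightarrow> real" where
  "tail_bound a h n k =
    (if a * real (h * k) \<le> 1 then exp 1
     else sqrt 8 * real (h * n) * ((2 * exp 1 / a) ^ 3 * (real n / real k) ^ 4) powr (a * real (h * k) / 2))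
    / real (n choose k) ^ h"

lemma squared_binomial_power_le:
  "(real (n choose k) ^ h)\<^sup>2 \<le> real ((2 * (h * n)) choose (2 * (h * k)))"
proof -
  have "(n choose k) ^ (2 * h) \<le> (2 * h * n) choose (2 * h * k)"
    by (rule binomial_power_le)
  then have "real ((n choose k) ^ (2 * h)) \<le> real ((2 * (h * n)) choose (2 * (h * k)))"
    unfolding of_nat_le_iff by (simp add: mult.assoc)
  then show ?thesis
    by (simp add: mult.commute flip: power_mult)
qed

lemma sparse_cut_tail:
  assumes "splits (h * n) S T" "card S = h * k" "h \<ge> 2" "k \<ge> 1" "2 * k \<le> n" "0 < a" "a \<le> 1"
  shows "measure_pmf.prob (mini_tree (h * n)) {G. real (cross S T G) < a * real (h * k)} \<le> tail_bound a h n k"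
proof -
  define N m where "N = h * n" and "m = h * k"
  define D where "D = real (n choose k) ^ h"
  have m: "0 < m" "2 * m \<le> N" "N \<ge> 1"
    using assms by (auto simp: N_def m_def)
  obtain t where t: "N = Suc t"
    using m(3) by (metis One_nat_def Suc_le_D)
  have ratio: "real N / real m = real n / real k"
    using assms by (simp add: N_def m_def)
  have D: "D > 0"
    using assms by (simp add: D_def)
  have D2: "D\<^sup>2 \<le> real ((2 * N) choose (2 * m))"
    unfolding D_def N_def m_def by (rule squared_binomial_power_le)
  have low: "D\<^sup>2 * (real m / real (2 * N)) ^ cross S T G / 1 \<le> arrangements (vol S G) (vol T G)"
    if "G \<in> set_pmf (mini_tree N)" "real (cross S T G) < a * real m" for G
  proof -
    have "a * real m \<le> real m"
      using assms by (simp add: mult_left_le_one_le)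
    then have "cross S T G \<le> m"
      using that(2) by linarith
    moreover have "grown N G"
      using that(1) t grown_mini_tree by simp
    ultimately have "real ((2 * N) choose (2 * m)) * (real m / real (2 * N)) ^ cross S T G
        \<le> arrangements (vol S G) (vol T G)"
      using assms m by (intro arrangements_final) (auto simp: N_def m_def)
    moreover have "D\<^sup>2 * (real m / real (2 * N)) ^ cross S T G
        \<le> real ((2 * N) choose (2 * m)) * (real m / real (2 * N)) ^ cross S T G"
      using D2 by (intro mult_right_mono) auto
    ultimately show ?thesis
      by linarith
  qed
  have "(\<integral>\<^sup>+G. ennreal (weight arrangements vol S T N (a * real m / real N) G) \<partial>measure_pmf (mini_tree N))
      \<le> ennreal ((1 + a * real m / real N) ^ N)"
    using assms m by (intro weight_expectation_mini_tree) (auto simp: N_def)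
  note tail = weighted_tail[OF assms(6,7) m(1) _ D zero_less_one refl this[unfolded weight_def] low, unfolded ratio]
  have small: "measure_pmf.prob (mini_tree N) {G. real (cross S T G) < a * real m} \<le> exp 1 / D"
    if "a * real m \<le> 1"
    using tail(2) m that by simp
  have "1 \<le> sqrt 8 * real N"
  proof -
    have "1 * 1 \<le> sqrt 8 * real N"
      using m(3) by (intro mult_mono) auto
    then show ?thesis
      by simp
  qed
  then have "1 / D * ((2 * exp 1 / a) ^ 3 * (real n / real k) ^ 4) powr (a * real m / 2)
    \<le> sqrt 8 * real N / D * ((2 * exp 1 / a) ^ 3 * (real n / real k) ^ 4) powr (a * real m / 2)"
    using D by (intro mult_right_mono divide_right_mono) auto
  moreover have "measure_pmf.prob (mini_tree N) {G. real (cross S T G) < a * real m}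
      \<le> 1 / D * ((2 * exp 1 / a) ^ 3 * (real n / real k) ^ 4) powr (a * real m / 2)"
    using tail(1) m by simp
  ultimately show ?thesis
    using small by (auto simp: tail_bound_def N_def m_def D_def)
qed

lemma sparse_cut_tail_tilde:
  assumes "splits (h * n) S T" "card S = h * k" "h \<ge> 2" "k \<ge> 1" "2 * k \<le> n" "0 < a" "a \<le> 1"
  shows "measure_pmf.prob (mini_tree_tilde (h * n)) {G. real (cross S T G) < a * real (h * k)}
    \<le> tail_bound a h n k"
proof -
  define N m where "N = h * n" and "m = h * k"
  define D where "D = real (n choose k) ^ h"
  have "2 * 1 \<le> h * k"
    using assms by (intro mult_le_mono) auto
  then have m: "2 \<le> m" "2 * m \<le> N" "N \<ge> 1"
    using assms by (auto simp: N_def m_def)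
  obtain t where t: "N = Suc t"
    using m(3) by (metis One_nat_def Suc_le_D)
  have ratio: "real N / real m = real n / real k"
    using assms by (simp add: N_def m_def)
  have D: "D > 0"
    using assms by (simp add: D_def)
  have D2: "D\<^sup>2 \<le> real ((2 * N) choose (2 * m))"
    unfolding D_def N_def m_def by (rule squared_binomial_power_le)
  have cross: "cross S T G \<ge> 1" if "G \<in> set_pmf (mini_tree_tilde N)" for G
  proof -
    have card: "card S + card T = N"
      using assms(1) splits_finite[OF assms(1)] card_Un_disjoint[of S T] by (auto simp: splits_def N_def)
    have "card S > 0" "card T > 0"
      using assms(2) card m unfolding m_def by linarith+
    then have ST: "S \<union> T = {1..Suc t}" "S \<noteq> {}" "T \<noteq> {}"
      using assms(1) t by (auto simp: splits_def N_def)
    have "1 \<in> S \<or> 1 \<in> T"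
      using ST(1) by auto
    then show ?thesis
    proof
      assume "1 \<in> T"
      moreover have "S \<inter> {1..Suc t} = S"
        using ST(1) by blast
      ultimately show ?thesis
        using tilde_connected[OF assms(1), of G t] that t ST(2) by (simp add: N_def)
    next
      assume "1 \<in> S"
      moreover have "T \<inter> {1..Suc t} = T"
        using ST(1) by blast
      ultimately show ?thesis
        using tilde_connected[OF splits_commute[OF assms(1)], of G t] that t ST(3)
        by (simp add: N_def cross_commute)
    qed
  qed
  (* The loss of order N in this model is too large for small sets, but then there is no sparse cut. *)
  show ?thesis
  proof (cases "a * real m \<le> 1")
    case True
    have "\<not> real (cross S T G) < a * real m" if "G \<in> set_pmf (mini_tree_tilde N)" for G
      using cross[OF that] True by linarith
    then have "measure_pmf.prob (mini_tree_tilde N) {G. real (cross S T G) < a * real m} = 0"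
      by (auto simp: measure_pmf_zero_iff)
    also have "0 \<le> tail_bound a h n k"
      by (simp add: tail_bound_def)
    finally show ?thesis
      by (simp add: N_def m_def)
  next
    case False
    have low: "D\<^sup>2 * (real m / real (2 * N)) ^ cross S T G / (8 * (real N)\<^sup>2)
        \<le> arrangements_tilde (vol_tilde S G) (vol_tilde T G)"
      if "G \<in> set_pmf (mini_tree_tilde N)" "real (cross S T G) < a * real m" for G
    proof -
      have "a * real m \<le> real m"
        using assms by (simp add: mult_left_le_one_le)
      then have "cross S T G \<le> m"
        using that(2) by linarith
      moreover have "grown N G"
        using that(1) t grown_mini_tree_tilde by simp
      ultimately have "real ((2 * N) choose (2 * m)) * (real m / real (2 * N)) ^ cross S T G / (8 * (real N)\<^sup>2)
          \<le> arrangements_tilde (vol_tilde S G) (vol_tilde T G)"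
        using assms m cross[OF that(1)] by (intro arrangements_tilde_final) (auto simp: N_def m_def)
      moreover have "D\<^sup>2 * (real m / real (2 * N)) ^ cross S T G / (8 * (real N)\<^sup>2)
          \<le> real ((2 * N) choose (2 * m)) * (real m / real (2 * N)) ^ cross S T G / (8 * (real N)\<^sup>2)"
        using D2 by (intro divide_right_mono mult_right_mono) auto
      ultimately show ?thesis
        by linarith
    qed
    have "(\<integral>\<^sup>+G. ennreal (weight arrangements_tilde vol_tilde S T N (a * real m / real N) G) \<partial>measure_pmf (mini_tree_tilde N))
        \<le> ennreal ((1 + a * real m / real N) ^ N)"
      using assms m by (intro weight_expectation_mini_tree_tilde) (auto simp: N_def)
    note tail = weighted_tail(1)[OF assms(6,7) _ _ D _ refl this[unfolded weight_def] low, simplified ratio]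
    have "measure_pmf.prob (mini_tree_tilde N) {G. real (cross S T G) < a * real m}
        \<le> sqrt (8 * (real N)\<^sup>2) / D * ((2 * exp 1 / a) ^ 3 * (real n / real k) ^ 4) powr (a * real m / 2)"
      using tail m by simp
    then show ?thesis
      using False by (simp add: tail_bound_def N_def m_def D_def real_sqrt_mult)
  qed
qed

section \<open>The union bound\<close>

definition preimage :: "nat \<Rightarrow> nat \<Rightarrow> nat set \<Rightarrow> nat set" where
  "preimage h n A = {j \<in> {1..h * n}. block h j \<in> A}"

lemma block_range:
  assumes "h \<ge> 1" "j \<in> {1..h * n}"
  shows "block h j \<in> {1..n}"
proof -
  have "(j - 1) div h < n"
    using assms by (subst div_less_iff_less_mult) (auto simp: mult.commute)
  then show ?thesis
    by (simp add: block_def)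
qed

lemma block_fiber:
  assumes "h \<ge> 1" "i \<in> {1..n}"
  shows "{j \<in> {1..h * n}. block h j = i} = {h * (i - 1) + 1..h * (i - 1) + h}"
proof -
  have "h * (i - 1) + h \<le> h * n"
  proof -
    have "h * (i - 1) + h = h * i"
      using assms by (cases i) auto
    also have "\<dots> \<le> h * n"
      using assms by (intro mult_left_mono) auto
    finally show ?thesis .
  qed
  moreover have "block h j = i \<longleftrightarrow> j \<in> {h * (i - 1) + 1..h * (i - 1) + h}" if "j \<ge> 1" for j
    using block_eq_iff[OF assms(1) _ that, of i] assms(2) by simp
  ultimately show ?thesis
    by fastforce
qed

lemma card_preimage:
  assumes "h \<ge> 1" "A \<subseteq> {1..n}"
  shows "card (preimage h n A) = h * card A"
proof -
  have fin: "finite A"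
    using assms(2) finite_subset by blast
  have "preimage h n A = (\<Union>i\<in>A. {j \<in> {1..h * n}. block h j = i})"
    by (auto simp: preimage_def)
  also have "card \<dots> = (\<Sum>i\<in>A. card {j \<in> {1..h * n}. block h j = i})"
    using fin by (intro card_UN_disjoint) auto
  also have "\<dots> = (\<Sum>i\<in>A. h)"
  proof (intro sum.cong refl)
    fix i assume "i \<in> A"
    then have "{j \<in> {1..h * n}. block h j = i} = {h * (i - 1) + 1..h * (i - 1) + h}"
      using assms by (intro block_fiber) auto
    then show "card {j \<in> {1..h * n}. block h j = i} = h"
      by simp
  qed
  finally show ?thesis
    by (simp add: mult.commute)
qed

lemma splits_preimage:
  assumes "h \<ge> 1" "A \<subseteq> {1..n}"
  shows "splits (h * n) (preimage h n A) (preimage h n ({1..n} - A))"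
  using block_range[OF assms(1)] by (auto simp: splits_def preimage_def)

lemma verts_merge:
  assumes "h \<ge> 1" "grown (h * n) G"
  shows "verts (merge h G) = {1..n}"
proof -
  have "i \<in> block h ` {1..h * n}" if "i \<in> {1..n}" for i
  proof -
    have "h * (i - 1) + 1 \<in> {j \<in> {1..h * n}. block h j = i}"
      unfolding block_fiber[OF assms(1) that] using assms(1) by simp
    then show ?thesis
      by force
  qed
  then have "block h ` {1..h * n} = {1..n}"
    using block_range[OF assms(1)] by blast
  then show ?thesis
    using grown_wf_at[OF assms(2)] by (simp add: merge_def wf_at_def)
qed

lemma cut_size_merge:
  assumes "h \<ge> 1" "grown (h * n) G" "A \<subseteq> {1..n}"
  shows "cut_size (merge h G) A = cross (preimage h n A) (preimage h n ({1..n} - A)) G"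
proof -
  have "(\<exists>u\<in>A. \<exists>v\<in>{1..n} - A. map_uprod (block h) e = Upair u v)
      \<longleftrightarrow> (\<exists>u\<in>preimage h n A. \<exists>v\<in>preimage h n ({1..n} - A). e = Upair u v)" if "e \<in># edges G" for e
  proof -
    obtain x y where e: "e = Upair x y"
      by (cases e) auto
    then have "x \<in> {1..h * n}" "y \<in> {1..h * n}"
      using that grown_wf_at[OF assms(2)] by (auto simp: wf_at_def)
    then show ?thesis
      using block_range[OF assms(1)] unfolding e preimage_def map_uprod_simps Upair_inject by blast
  qed
  then show ?thesis
    unfolding cut_size_def cross_def verts_merge[OF assms(1,2)]
    by (simp add: merge_def filter_mset_image_mset cong: filter_mset_cong)
qed

lemma small_expansion_witness:
  assumes "\<not> ereal r \<le> edge_expansion g" "verts g = {1..n}" "n \<ge> 2"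
  obtains A where "A \<subseteq> {1..n}" "1 \<le> card A" "2 * card A \<le> n" "real (cut_size g A) < r * real (card A)"
proof -
  define \<A> where "\<A> = {A. A \<subseteq> {1..n} \<and> 1 \<le> card A \<and> real (card A) \<le> real n / 2}"
  have fin: "finite \<A>"
    by (rule finite_subset[of _ "Pow {1..n}"]) (auto simp: \<A>_def)
  have "{1} \<in> \<A>"
    using assms(3) by (auto simp: \<A>_def)
  have "edge_expansion g = ereal (Min ((\<lambda>A. real (cut_size g A) / real (card A)) ` \<A>))"
    using assms(2,3) by (auto simp: edge_expansion_def \<A>_def image_def intro!: arg_cong[of _ _ Min])
  then have "Min ((\<lambda>A. real (cut_size g A) / real (card A)) ` \<A>) < r"
    using assms(1) by simp
  moreover have "Min ((\<lambda>A. real (cut_size g A) / real (card A)) ` \<A>)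
      \<in> (\<lambda>A. real (cut_size g A) / real (card A)) ` \<A>"
    using fin \<open>{1} \<in> \<A>\<close> by (intro Min_in) auto
  ultimately obtain A where "A \<in> \<A>" "real (cut_size g A) / real (card A) < r"
    by auto
  then show ?thesis
    using that[of A] by (auto simp: \<A>_def field_simps)
qed

text \<open>
  Cutting the merged graph along a set of vertices is cutting the graph of mini-vertices along the
  corresponding union of blocks, so the bounds for fixed sets can be summed over all vertex sets of
  at most half the size.
\<close>

lemma expansion_union_bound:
  fixes M :: "nat multigraph pmf" and \<beta> :: "nat \<Rightarrow> real"
  assumes "h \<ge> 1" "n \<ge> 2" "\<And>G. G \<in> set_pmf M \<Longrightarrow> grown (h * n) G"
    and tail: "\<And>S T k. splits (h * n) S T \<Longrightarrow> card S = h * k \<Longrightarrow> k \<ge> 1 \<Longrightarrow> 2 * k \<le> n \<Longrightarrow>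
      measure_pmf.prob M {G. real (cross S T G) < a * real (h * k)} \<le> \<beta> k"
  shows "measure_pmf.prob (map_pmf (merge h) M) {g. edge_expansion g \<ge> ereal (a * real h)}
    \<ge> 1 - (\<Sum>k=1..n div 2. real (n choose k) * \<beta> k)"
proof -
  define \<A> where "\<A> k = {A. A \<subseteq> {1..n} \<and> card A = k}" for k
  have fin: "finite (\<A> k)" for k
    by (rule finite_subset[of _ "Pow {1..n}"]) (auto simp: \<A>_def)
  define bad where
    "bad k A = {G. real (cross (preimage h n A) (preimage h n ({1..n} - A)) G) < a * real (h * k)}" for k A
  define low where "low = {G. \<not> ereal (a * real h) \<le> edge_expansion (merge h G)}"
  have "low \<inter> set_pmf M \<subseteq> (\<Union>k\<in>{1..n div 2}. \<Union>A\<in>\<A> k. bad k A)"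
  proof
    fix G assume G: "G \<in> low \<inter> set_pmf M"
    then have grown: "grown (h * n) G"
      using assms(3) by simp
    from G obtain A where A: "A \<subseteq> {1..n}" "1 \<le> card A" "2 * card A \<le> n"
        "real (cut_size (merge h G) A) < a * real h * real (card A)"
      using small_expansion_witness[OF _ verts_merge[OF assms(1) grown] assms(2), of "a * real h"]
      by (auto simp: low_def)
    then have "G \<in> bad (card A) A"
      using cut_size_merge[OF assms(1) grown A(1)] by (simp add: bad_def mult.assoc)
    moreover have "A \<in> \<A> (card A)" "card A \<in> {1..n div 2}"
      using A by (auto simp: \<A>_def)
    ultimately show "G \<in> (\<Union>k\<in>{1..n div 2}. \<Union>A\<in>\<A> k. bad k A)"
      by blast
  qed
  then have "measure_pmf.prob M low \<le> measure_pmf.prob M (\<Union>k\<in>{1..n div 2}. \<Union>A\<in>\<A> k. bad k A)"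
    by (metis measure_Int_set_pmf measure_pmf.finite_measure_mono sets_measure_pmf UNIV_I)
  also have "\<dots> \<le> (\<Sum>k=1..n div 2. measure_pmf.prob M (\<Union>A\<in>\<A> k. bad k A))"
    by (intro measure_pmf.finite_measure_subadditive_finite) auto
  also have "\<dots> \<le> (\<Sum>k=1..n div 2. \<Sum>A\<in>\<A> k. measure_pmf.prob M (bad k A))"
    using fin by (intro sum_mono measure_pmf.finite_measure_subadditive_finite) auto
  also have "\<dots> \<le> (\<Sum>k=1..n div 2. \<Sum>A\<in>\<A> k. \<beta> k)"
  proof (intro sum_mono)
    fix k A assume k: "k \<in> {1..n div 2}" and A: "A \<in> \<A> k"
    then show "measure_pmf.prob M (bad k A) \<le> \<beta> k"
      unfolding bad_def
      by (intro tail splits_preimage[OF assms(1)]) (auto simp: \<A>_def card_preimage[OF assms(1)])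
  qed
  also have "\<dots> = (\<Sum>k=1..n div 2. real (n choose k) * \<beta> k)"
    by (simp add: \<A>_def n_subsets)
  finally have "measure_pmf.prob M low \<le> (\<Sum>k=1..n div 2. real (n choose k) * \<beta> k)" .
  moreover have "measure_pmf.prob M (- low) = 1 - measure_pmf.prob M low"
    using measure_pmf.prob_compl[of low M] by (simp add: Compl_eq_Diff_UNIV)
  moreover have "merge h -` {g. edge_expansion g \<ge> ereal (a * real h)} = - low"
    by (auto simp: low_def)
  ultimately show ?thesis
    by simp
qed

text \<open>
  The place where the numerical constant of the theorem matters. The left side, raised to the power
  \<open>h * k / 2\<close>, is what allowing crossing edges costs, and \<open>z powr (h * k / 2)\<close> is available for
  \<open>h \<ge> 2\<close>; the exponent 0.9 instead of 1 leaves a margin. The worst case is \<open>z = 2\<close>, which is why 2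
  is compared with \<open>x = 2 * exp 1 / 0.03418\<close>: \<open>x\<close> is about 159.1 and \<open>2 powr 7.4\<close> about 168.9.
\<close>

lemma rate_constant:
  fixes z :: real
  assumes "z \<ge> 2"
  shows "((2 * exp 1 / 0.03418) ^ 3 * z ^ 4) powr 0.03418 \<le> z powr 0.9"
proof -
  define x :: real where "x = 2 * exp 1 / 0.03418"
  have x: "0 < x" "x \<le> 159.2"
    using e_less_272 by (auto simp: x_def)
  have "x ^ 5 \<le> 159.2 ^ 5"
    using x by (intro power_mono) auto
  also have "\<dots> \<le> (2 :: real) ^ 37"
    by (simp add: power_divide)
  also have "\<dots> = (2 powr 7.4) ^ 5"
    by (simp add: powr_power)
  finally have "x \<le> 2 powr 7.4"
    using power_le_imp_le_base[of x 4 "2 powr 7.4"] by simp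
  then have "x ^ 3 \<le> (z powr 7.4) ^ 3"
    using x assms powr_mono2[of "7.4" 2 z] by (intro power_mono) auto
  then have "x ^ 3 * z ^ 4 \<le> (z powr 7.4) ^ 3 * z ^ 4"
    using assms by (intro mult_right_mono) auto
  also have "\<dots> = z powr (7.4 * 3) * z powr 4"
    using assms by (simp add: powr_power)
  also have "\<dots> = z powr 26.2"
    by (subst powr_add[symmetric]) simp
  finally have "(x ^ 3 * z ^ 4) powr 0.03418 \<le> (z powr 26.2) powr 0.03418"
    using x assms by (intro powr_mono2) auto
  also have "\<dots> = z powr (26.2 * 0.03418)"
    by (simp add: powr_powr)
  also have "\<dots> \<le> z powr 0.9"
    using assms by (intro powr_mono) auto
  finally show ?thesis
    by (simp add: x_def)
qed

text \<open>
  Of the \<open>h\<close> factors \<open>n choose k\<close> in the bound for a fixed set, the number of sets uses up one. For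
  \<open>h \<ge> 2\<close> at least half of them remain, and each is at least \<open>(n / k) ^ k\<close>. If a sparse cut can have
  an edge, then \<open>0.03418 * h * k > 1\<close>, so the margin in the exponent gives a power of \<open>n / k\<close> beyond
  \<open>0.05 / 0.03418 > 1.4\<close>, of which 1.2 are spent on the factor \<open>n\<close> and the rest on summability in
  \<open>k\<close>. Otherwise \<open>k\<close> is bounded, and a single factor \<open>n choose k \<ge> n\<close> is enough.
\<close>

lemma tail_bound_term:
  assumes "h \<ge> 2" "k \<ge> 1" "2 * k \<le> n"
  shows "real (n choose k) * tail_bound 0.03418 h n k
    \<le> 32 * real h * real n powr (- 0.2) * ((real k)\<^sup>2 * (2 powr (- 0.1)) ^ k)"
proof -
  define C where "C = real (n choose k)"
  define z where "z = real n / real k"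
  have nk: "real n \<ge> 2" "real k \<ge> 1" "real h \<ge> 2" "2 * real k \<le> real n"
    using assms by auto
  have z: "z \<ge> 2"
    using nk by (simp add: z_def field_simps)
  have decay: "(2 powr (- 0.1)) ^ k = (2 :: real) powr (- (0.1 * real k))"
    by (simp add: powr_power)
  have "n choose 1 \<le> n choose k"
    using assms by (intro binomial_central_le) auto
  then have C: "real n \<le> C"
    by (simp add: C_def)
  obtain g where g: "h = Suc g" "g \<ge> 1"
    using assms(1) by (cases h) auto
  have cancel: "C * (B / C ^ h) = B / C ^ g" for B
    using C nk g by (simp add: field_simps)
  show ?thesis
  proof (cases "0.03418 * real (h * k) \<le> 1")
    case True
    have "C ^ 1 \<le> C ^ g"
      using C nk g by (intro power_increasing) auto
    then have "real n \<le> C ^ g"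
      using C by simp
    then have "C * tail_bound 0.03418 h n k \<le> exp 1 / real n"
      using True nk unfolding tail_bound_def C_def[symmetric] cancel by (simp add: frac_le)
    also have "\<dots> = exp 1 * real n powr (- 1)"
      using nk by (simp add: powr_minus_divide)
    also have "\<dots> \<le> 2.72 * real n powr (- 0.2)"
      using e_less_272 nk by (intro mult_mono powr_mono) auto
    also have "\<dots> \<le> (2.72 * real h) * real n powr (- 0.2)"
      using nk by (intro mult_right_mono) auto
    also have "\<dots> \<le> 32 * real h * real n powr (- 0.2) * (1 * (1 / 4))"
      by (simp add: mult_right_mono)
    also have "\<dots> \<le> 32 * real h * real n powr (- 0.2) * ((real k)\<^sup>2 * (2 powr (- 0.1)) ^ k)"
    proof (intro mult_left_mono mult_mono)
      have "2 * real k \<le> real h * real k"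
        using nk by (intro mult_right_mono) auto
      then have "real k \<le> 20"
        using True by simp
      then have "2 powr (- 2) \<le> (2 :: real) powr (- (0.1 * real k))"
        by (intro powr_mono) auto
      then show "1 / 4 \<le> ((2 :: real) powr (- 0.1)) ^ k"
        unfolding decay by (simp add: powr_minus powr_numeral)
    qed (use nk in auto)
    finally show ?thesis
      by (simp add: C_def)
  next
    case False
    define R where "R = (2 * exp 1 / 0.03418) ^ 3 * z ^ 4"
    have R: "R > 0" "R powr 0.03418 \<le> z powr 0.9"
      using rate_constant[OF z] z by (auto simp: R_def)
    have "R powr (0.03418 * real (h * k) / 2) = (R powr 0.03418) powr (real (h * k) / 2)"
      by (simp add: powr_powr)
    also have "\<dots> \<le> (z powr 0.9) powr (real (h * k) / 2)"
      using R by (intro powr_mono2) auto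
    also have "\<dots> = z powr (0.45 * real (h * k))"
      by (simp add: powr_powr)
    finally have num: "R powr (0.03418 * real (h * k) / 2) \<le> z powr (0.45 * real (h * k))" .
    have "z powr (0.5 * real (h * k)) \<le> z powr real (k * g)"
    proof (intro powr_mono)
      have "real h \<le> 2 * real g"
        using g by simp
      then have "real h * real k \<le> 2 * real g * real k"
        by (intro mult_right_mono) auto
      then show "0.5 * real (h * k) \<le> real (k * g)"
        by (simp add: mult_ac)
    qed (use z in auto)
    also have "\<dots> = (z ^ k) ^ g"
      using z by (simp add: powr_realpow power_mult flip: of_nat_mult)
    also have "\<dots> \<le> C ^ g"
      using binomial_ge_n_over_k_pow_k[of k n, where 'a = real] assms z
      by (intro power_mono) (auto simp: C_def z_def)
    finally have den: "z powr (0.5 * real (h * k)) \<le> C ^ g" .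
    have "C * tail_bound 0.03418 h n k
        = sqrt 8 * real (h * n) * R powr (0.03418 * real (h * k) / 2) / C ^ g"
      using False unfolding tail_bound_def C_def[symmetric] cancel by (simp add: R_def z_def)
    also have "\<dots> \<le> sqrt 8 * real (h * n) * z powr (0.45 * real (h * k)) / z powr (0.5 * real (h * k))"
      using num den z by (intro frac_le mult_left_mono) auto
    also have "\<dots> = sqrt 8 * real (h * n) * (z powr (- 1.2) * z powr (- (0.05 * real (h * k) - 1.2)))"
    proof -
      have "0.45 * x - 0.5 * x = - 1.2 + (- (0.05 * x - 1.2))" for x :: real
        by simp
      then show ?thesis
        unfolding times_divide_eq_right[symmetric] powr_diff[symmetric] powr_add[symmetric] by simp
    qed
    \<comment> \<open>The power \<open>z powr (- 1.2)\<close> turns \<open>n\<close> into \<open>n powr (- 0.2)\<close>; in the rest, \<open>z\<close> is replaced by 2.\<close>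
    also have "\<dots> \<le> 4 * real (h * n) * (z powr (- 1.2) * (4 * 2 powr (- (0.1 * real k))))"
    proof (intro mult_mono mult_left_mono)
      show "sqrt 8 \<le> (4 :: real)"
        by (intro real_le_lsqrt) auto
      have "0.05 * (2 * real k) \<le> 0.05 * (real h * real k)"
        using nk by (intro mult_left_mono mult_right_mono) auto
      have "z powr (- (0.05 * real (h * k) - 1.2)) \<le> 2 powr (- (0.05 * real (h * k) - 1.2))"
        using z False by (intro powr_mono2') auto
      also have "\<dots> \<le> 2 powr (2 + (- (0.1 * real k)))"
        using \<open>0.05 * (2 * real k) \<le> _\<close> by (intro powr_mono) auto
      also have "\<dots> = 4 * 2 powr (- (0.1 * real k))"
        by (subst powr_add) simp
      finally show "z powr (- (0.05 * real (h * k) - 1.2)) \<le> 4 * 2 powr (- (0.1 * real k))" .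
    qed auto
    also have "\<dots> = 16 * real h * (real n * z powr (- 1.2)) * 2 powr (- (0.1 * real k))"
      by simp
    also have "real n * z powr (- 1.2) = real n powr (- 0.2) * real k powr 1.2"
    proof -
      have "real n powr (- 0.2) = real n * real n powr (- 1.2)"
        using nk powr_mult_base[of "real n" "- 1.2"] by simp
      then show ?thesis
        using nk by (simp add: z_def powr_divide powr_minus_divide)
    qed
    also have "16 * real h * (real n powr (- 0.2) * real k powr 1.2) * 2 powr (- (0.1 * real k))
        \<le> 32 * real h * (real n powr (- 0.2) * (real k)\<^sup>2) * 2 powr (- (0.1 * real k))"
    proof (intro mult_right_mono mult_mono mult_left_mono)
      have "real k powr 1.2 \<le> real k powr 2"
        using nk by (intro powr_mono) auto
      then show "real k powr 1.2 \<le> (real k)\<^sup>2"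
        using nk by (simp add: powr_numeral)
    qed auto
    finally show ?thesis
      unfolding decay C_def by (simp add: mult_ac)
  qed
qed

lemma summable_decay: "summable (\<lambda>k. (real k)\<^sup>2 * (2 powr (- 0.1 :: real)) ^ k)"
proof (rule summable_comparison_test_bigo)
  show "summable (\<lambda>k. norm (inverse (real k ^ 2)))"
    using inverse_power_summable[of 2, where 'a = real] by simp
  show "(\<lambda>k. (real k)\<^sup>2 * (2 powr (- 0.1 :: real)) ^ k) \<in> O(\<lambda>k. inverse (real k ^ 2))"
    by real_asymp
qed

theorem corollary1p5:
  fixes h :: nat and G :: "nat \<Rightarrow> nat multigraph pmf"
  assumes "h \<ge> 2"
    and "G = pref_attach h \<or> G = pref_attach_tilde h"
  shows "\<exists>c::real. c > 0 \<and>
    (\<exists>\<epsilon> :: nat \<Rightarrow> real. \<epsilon> \<in> o(\<lambda>n. real n powr (- c)) \<and>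
      (\<forall>n\<ge>1. measure_pmf.prob (G n) {g. edge_expansion g \<ge> ereal (0.03418 * real h)} \<ge> 1 - \<epsilon> n))"
proof -
  define d :: "nat \<Rightarrow> real" where "d k = (real k)\<^sup>2 * (2 powr (- 0.1)) ^ k" for k
  define B where "B = suminf d"
  define \<epsilon> where "\<epsilon> n = 32 * real h * B * real n powr (- 0.2)" for n
  have prob: "measure_pmf.prob (G n) {g. edge_expansion g \<ge> ereal (0.03418 * real h)} \<ge> 1 - \<epsilon> n"
    if n: "n \<ge> 1" for n
  proof -
    obtain M where M: "G n = map_pmf (merge h) M"
        "\<And>H. H \<in> set_pmf M \<Longrightarrow> grown (h * n) H"
        "\<And>S T k. splits (h * n) S T \<Longrightarrow> card S = h * k \<Longrightarrow> k \<ge> 1 \<Longrightarrow> 2 * k \<le> n \<Longrightarrow>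
          measure_pmf.prob M {H. real (cross S T H) < 0.03418 * real (h * k)} \<le> tail_bound 0.03418 h n k"
    proof -
      have "h * n \<ge> 1"
        using n assms(1) by simp
      then obtain t where t: "h * n = Suc t"
        by (metis One_nat_def Suc_le_D)
      show thesis
        using assms(2)
      proof
        assume "G = pref_attach h"
        then show thesis
          using assms(1) t
          by (intro that[of "mini_tree (h * n)"] sparse_cut_tail) (auto simp: pref_attach_def grown_mini_tree)
      next
        assume "G = pref_attach_tilde h"
        then show thesis
          using assms(1) t
          by (intro that[of "mini_tree_tilde (h * n)"] sparse_cut_tail_tilde)
            (auto simp: pref_attach_tilde_def grown_mini_tree_tilde)
      qed
    qed
    have B: "sum d {1..m} \<le> B" for m
      unfolding B_def
    proof (rule sum_le_suminf)
      show "summable d"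
        unfolding d_def by (rule summable_decay)
    qed (auto simp: d_def)
    show ?thesis
    \<comment> \<open>With one vertex there is nothing to cut, and the expansion is infinite by convention.\<close>
    proof (cases "n = 1")
      case True
      have "edge_expansion (merge h H) = \<infinity>" if "H \<in> set_pmf M" for H
        using verts_merge[of h n H] M(2)[OF that] assms(1) True by (simp add: edge_expansion_def)
      then have "measure_pmf.prob M (merge h -` {g. edge_expansion g \<ge> ereal (0.03418 * real h)}) = 1"
        by (subst measure_pmf.prob_eq_1) (auto intro!: AE_pmfI)
      moreover have "\<epsilon> n \<ge> 0"
        using B[of 0] by (simp add: \<epsilon>_def)
      ultimately show ?thesis
        by (simp add: M(1))
    next
      case False
      have "(\<Sum>k=1..n div 2. real (n choose k) * tail_bound 0.03418 h n k)
          \<le> (\<Sum>k=1..n div 2. 32 * real h * real n powr (- 0.2) * d k)"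
        unfolding d_def using assms(1) by (intro sum_mono tail_bound_term) auto
      also have "\<dots> = 32 * real h * real n powr (- 0.2) * sum d {1..n div 2}"
        by (simp add: sum_distrib_left)
      also have "\<dots> \<le> 32 * real h * real n powr (- 0.2) * B"
        by (intro mult_left_mono B) auto
      finally have "(\<Sum>k=1..n div 2. real (n choose k) * tail_bound 0.03418 h n k) \<le> \<epsilon> n"
        by (simp add: \<epsilon>_def mult_ac)
      moreover have "measure_pmf.prob (G n) {g. edge_expansion g \<ge> ereal (0.03418 * real h)}
          \<ge> 1 - (\<Sum>k=1..n div 2. real (n choose k) * tail_bound 0.03418 h n k)"
        unfolding M(1) using assms(1) n False by (intro expansion_union_bound M(2,3)) auto
      ultimately show ?thesis
        by linarith
    qed
  qed
  have "(\<lambda>n. real n powr (- 0.2)) \<in> o(\<lambda>n. real n powr (- 0.1))"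
    by real_asymp
  then have "(\<lambda>n. C * real n powr (- 0.2)) \<in> o(\<lambda>n. real n powr (- 0.1))" for C
    by (cases "C = 0") simp_all
  then have "\<epsilon> \<in> o(\<lambda>n. real n powr (- 0.1))"
    by (simp only: \<epsilon>_def [abs_def])
  then show ?thesis
    using prob by (intro exI[of _ "0.1"] conjI exI[of _ \<epsilon>]) auto
qed

end
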